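(* There exists a constant $C > 0$ such that for all $r, k \in \mathbb{N}$ with $k \geq 2$ and $r \geq 2^{k^{C k}}$, \[ N^{\mathbb{R}}_{\frac{1}{2k-1}}(r) = \left \lfloor \frac{k}{k-1} (r-1) \right \rfloor. \]
   Context: $\mathbb{N}$ is the set of positive integers. Lines $l_1,\dots,l_n$ through the origin in $\mathbb{R}^r$ are equiangular with common angle $\arccos(\alpha)$ if, choosing a unit vector $v_i$ along each $l_i$, one has $|\langle v_i, v_j\rangle| = \alpha$ for all $i \neq j$. $N^{\mathbb{R}}_\alpha(r)$ denotes the maximum number of equiangular lines in $\mathbb{R}^r$ with common angle $\arccos(\alpha)$. *)

theory Defs
  imports Complex_Main "Jordan_Normal_Form.Matrix"
begin

text \<open>
  The dimension \<open>r\<close> is quantified inside the theorem, so \<open>\<real>\<^sup>r\<close> is the carrier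
  \<^term>\<open>carrier_vec r\<close> of real vectors with their standard scalar product.
\<close>

definition lines_through_origin :: "nat \<Rightarrow> real vec set set" where
  "lines_through_origin r =
     {l. \<exists>u \<in> carrier_vec r. u \<noteq> 0\<^sub>v r \<and> l = range (\<lambda>c. c \<cdot>\<^sub>v u)}"

definition unit_vectors_along :: "real vec set \<Rightarrow> real vec set" where
  "unit_vectors_along l = {v \<in> l. sqrt (v \<bullet> v) = 1}"

text \<open>
  Each line has exactly two unit vectors, \<open>v\<close> and \<open>- v\<close>, so the condition does not
  depend on the choice of unit vectors; it is required here for every choice.
\<close>

definition equiangular :: "real \<Rightarrow> real vec set set \<Rightarrow> bool" where
  "equiangular \<alpha> L \<longleftrightarrow>
     (\<forall>l \<in> L. \<forall>m \<in> L. l \<noteq> m \<longrightarrow>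
        (\<forall>u \<in> unit_vectors_along l. \<forall>v \<in> unit_vectors_along m. \<bar>u \<bullet> v\<bar> = \<alpha>))"

text \<open>
  For \<open>0 \<le> \<alpha> < 1\<close> the set below is nonempty and, by Gerzon's bound
  \<open>card L \<le> r (r + 1) / 2\<close>, finite, so that \<^const>\<open>Max\<close> is a genuine maximum.
\<close>

definition max_equiangular :: "real \<Rightarrow> nat \<Rightarrow> nat" where
  "max_equiangular \<alpha> r =
     Max {card L | L. finite L \<and> L \<subseteq> lines_through_origin r \<and> equiangular \<alpha> L}"

end

theory Submission
  imports Defs "HOL-Analysis.Convex" "HOL-Library.Indicator_Function"
begin

text \<open>
  Write \<open>\<alpha> = 1/(2k-1)\<close> and \<open>\<lambda> = k - 1 = (1-\<alpha>)/(2\<alpha>)\<close>.  Choose unit vectors along \<open>N\<close>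
  equiangular lines in \<open>\<real>\<^sup>d\<close> and join two of them by an edge when their inner product is
  \<open>-\<alpha>\<close>.  Up to the factor \<open>2\<alpha>\<close> the Gram matrix is \<open>\<lambda> I - A + J/2\<close>, where \<open>A\<close> is the adjacency
  matrix of this graph and \<open>J\<close> the all-ones matrix.  It is positive semidefinite of rank at most
  \<open>d\<close>, so \<open>N - d\<close> is at most the dimension of its kernel, and the question is how large the
  \<open>\<lambda>\<close>-eigenspace of \<open>A\<close> can be.  The complete graph on \<open>k\<close> vertices has largest eigenvalue
  exactly \<open>\<lambda>\<close>, and no smaller connected graph reaches \<open>\<lambda>\<close>; disjoint copies of it give the
  extremal configuration (\<open>many_equiangular_lines\<close>).

  For the upper bound there are two cases.  If no eigenvalue of \<open>A\<close> exceeds \<open>\<lambda>\<close>, then by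
  Perron--Frobenius each component contributes at most one dimension to the \<open>\<lambda>\<close>-eigenspace, and
  only if it has at least \<open>k\<close> vertices.  Kernel vectors of the Gram matrix are moreover orthogonal
  to the all-ones vector, which costs one more dimension, so that \<open>N - d \<le> N/k - 1\<close>
  (\<open>card_bound_if_form_bounded\<close>).

  Otherwise semidefiniteness on the hyperplane orthogonal to the all-ones vector makes one component
  \<open>C\<close> responsible for all of the spectrum at or above \<open>\<lambda>\<close>, and \<open>\<lambda>\<close> is not its largest
  eigenvalue.  The argument of Jiang, Tidor, Yao, Zhang and Zhao shows that its multiplicity is then
  only a small fraction of \<open>N\<close> (\<open>card_bound_if_form_exceeds\<close>): delete an \<open>r\<close>-net of \<open>C\<close>, and
  also the few vertices whose neighbourhood of a fixed large radius already has an eigenvalue above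
  \<open>\<lambda>\<close>.  The deleted net makes closed walks noticeably scarcer in each remaining neighbourhood
  (\<open>local_walk_bound\<close>), while a \<open>\<lambda>\<close>-eigenspace of large dimension would contain an eigenvector
  concentrated at one vertex, which forces many closed walks there
  (\<open>concentrated_solution\<close>, \<open>eigenvector_entry_bound\<close>).

  The second case needs a bound on the degrees.  Replacing some vectors by their negatives does not
  change the lines.  By Ramsey's theorem there is a large set of vectors with pairwise inner product
  \<open>\<alpha>\<close>; choosing every sign so as to agree with the majority of this set bounds all degrees by
  \<open>2^O(k^2)\<close> (\<open>degree_bound\<close>), since a vertex with more neighbours would violate semidefiniteness
  on an explicit vector (\<open>star_test\<close>).  A net of radius \<open>2k\<close> and walks of length
  \<open>k^O(k)\<close> suffice, so all estimates hold as soon as \<open>N \<ge> 2^(k^O(k))\<close>.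
\<close>

section \<open>Linear systems and Ramsey sets\<close>

text \<open>
  Gaussian elimination on functions: either an equation vanishes identically and can be dropped, or
  it determines one coordinate and is substituted into the others.  Vectors are functions on an
  arbitrary finite set, so that restricting the support needs no change of carrier.
\<close>

lemma homogeneous_system_nontrivial:
  fixes a :: "'i \<Rightarrow> 'v \<Rightarrow> real"
  assumes "finite I" "finite V" "card I < card V"
  shows "\<exists>x. (\<exists>v\<in>V. x v \<noteq> 0) \<and> (\<forall>v. v \<notin> V \<longrightarrow> x v = 0) \<and>
             (\<forall>i\<in>I. (\<Sum>v\<in>V. a i v * x v) = 0)"
  using assms
proof (induction I arbitrary: V a rule: finite_induct)
  case empty
  then obtain p where "p \<in> V" by fastforce
  then show ?case by (intro exI[of _ "\<lambda>v. if v = p then 1 else 0"]) auto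
next
  case (insert i I)
  show ?case
  proof (cases "\<forall>v\<in>V. a i v = 0")
    case True
    have "card I < card V" using insert by simp
    from insert.IH[OF insert.prems(1) this, of a] obtain x where
      x: "\<exists>v\<in>V. x v \<noteq> 0" "\<forall>v. v \<notin> V \<longrightarrow> x v = 0" "\<forall>j\<in>I. (\<Sum>v\<in>V. a j v * x v) = 0"
      by blast
    then show ?thesis using True by (intro exI[of _ x]) auto
  next
    case False
    then obtain p where p: "p \<in> V" "a i p \<noteq> 0" by blast
    define W where "W = V - {p}"
    have W: "finite W" "p \<notin> W" "V = insert p W" "card I < card W"
      using insert p by (auto simp: W_def)
    from insert.IH[OF W(1) W(4), of "\<lambda>j v. a j v - a j p / a i p * a i v"] obtain x where
      x: "\<exists>v\<in>W. x v \<noteq> 0" "\<forall>v. v \<notin> W \<longrightarrow> x v = 0"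
        "\<forall>j\<in>I. (\<Sum>v\<in>W. (a j v - a j p / a i p * a i v) * x v) = 0"
      by blast
    \<comment> \<open>The value at the pivot is determined by the eliminated equation.\<close>
    define y where "y = x(p := - (\<Sum>v\<in>W. a i v * x v) / a i p)"
    have y: "(\<Sum>v\<in>V. a j v * y v) = (\<Sum>v\<in>W. a j v * x v) - a j p / a i p * (\<Sum>v\<in>W. a i v * x v)" for j
    proof -
      have "(\<Sum>v\<in>W. a j v * y v) = (\<Sum>v\<in>W. a j v * x v)"
        using W by (intro sum.cong) (auto simp: y_def)
      then show ?thesis using W by (simp add: y_def)
    qed
    have "(\<Sum>v\<in>V. a j v * y v) = 0" if "j \<in> insert i I" for j
    proof (cases "j = i")
      case True
      then show ?thesis using y[of j] p by simp
    next
      case False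
      then have "(\<Sum>v\<in>W. (a j v - a j p / a i p * a i v) * x v) = 0" using x that by blast
      then show ?thesis unfolding y
        by (simp add: left_diff_distrib sum_subtractf sum_distrib_left mult.assoc)
    qed
    moreover have "\<exists>v\<in>V. y v \<noteq> 0" "\<forall>v. v \<notin> V \<longrightarrow> y v = 0"
      using x W by (auto simp: y_def)
    ultimately show ?thesis by (intro exI[of _ y]) auto
  qed
qed

lemma orthonormal_solutions:
  fixes a :: "'i \<Rightarrow> 'v \<Rightarrow> real"
  assumes "finite I" "finite V" "card I + m \<le> card V"
  shows "\<exists>B :: nat \<Rightarrow> 'v \<Rightarrow> real.
           (\<forall>j<m. (\<forall>v. v \<notin> V \<longrightarrow> B j v = 0) \<and> (\<forall>i\<in>I. (\<Sum>v\<in>V. a i v * B j v) = 0)) \<and>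
           (\<forall>j<m. \<forall>l<m. (\<Sum>v\<in>V. B j v * B l v) = (if j = l then 1 else 0))"
  using assms(3)
proof (induction m)
  case 0
  then show ?case by simp
next
  case (Suc m)
  then have "card I + m \<le> card V" by simp
  from Suc.IH[OF this] obtain B :: "nat \<Rightarrow> 'v \<Rightarrow> real" where
    B: "\<And>j v. j < m \<Longrightarrow> v \<notin> V \<Longrightarrow> B j v = 0"
       "\<And>j i. j < m \<Longrightarrow> i \<in> I \<Longrightarrow> (\<Sum>v\<in>V. a i v * B j v) = 0"
       "\<And>j l. j < m \<Longrightarrow> l < m \<Longrightarrow> (\<Sum>v\<in>V. B j v * B l v) = (if j = l then 1 else 0)"
    by blast
  \<comment> \<open>The previous solutions become further equations, which force orthogonality to them.\<close>
  define J where "J = Inl ` I \<union> Inr ` {..<m}"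
  have "card J = card I + m"
    unfolding J_def using assms(1)
    by (subst card_Un_disjoint) (auto simp: card_image)
  then have "card J < card V" "finite J" using Suc.prems assms(1) by (auto simp: J_def)
  from homogeneous_system_nontrivial[OF this(2) assms(2) this(1), of "case_sum a B"]
  obtain x where x: "\<exists>v\<in>V. x v \<noteq> 0" "\<forall>v. v \<notin> V \<longrightarrow> x v = 0"
      and xJ: "\<forall>j\<in>J. (\<Sum>v\<in>V. case_sum a B j v * x v) = 0"
    by blast
  have xI: "(\<Sum>v\<in>V. a i v * x v) = 0" if "i \<in> I" for i
    using xJ that by (force simp: J_def)
  have xB: "(\<Sum>v\<in>V. B j v * x v) = 0" if "j < m" for j
    using xJ that by (force simp: J_def)
  define n where "n = (\<Sum>v\<in>V. (x v)\<^sup>2)"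
  have n: "n > 0"
  proof -
    from x(1) obtain p where "p \<in> V" "x p \<noteq> 0" by blast
    then show ?thesis
      unfolding n_def using assms(2) by (intro sum_pos2[of V p]) auto
  qed
  define y where "y = (\<lambda>v. x v / sqrt n)"
  have yy: "(\<Sum>v\<in>V. y v * y v) = 1"
    using n by (simp add: y_def n_def power2_eq_square flip: sum_divide_distrib)
  have By: "(\<Sum>v\<in>V. B j v * y v) = 0" "(\<Sum>v\<in>V. y v * B j v) = 0" if "j < m" for j
    using xB[OF that] by (simp_all add: y_def mult.commute flip: sum_divide_distrib)
  have Iy: "(\<Sum>v\<in>V. a i v * y v) = 0" if "i \<in> I" for i
    using xI[OF that] by (simp add: y_def flip: sum_divide_distrib)
  show ?case
    by (rule exI[of _ "B(m := y)"])
       (use B By Iy yy x(2) in \<open>auto simp: less_Suc_eq y_def\<close>)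
qed

text \<open>
  This replaces the trace in the usual argument that bounds a multiplicity by counting closed walks.
  The diagonal entries of the orthogonal projection onto an \<open>m\<close>-dimensional space sum to \<open>m\<close>,
  so one of them, at \<open>p\<close>, is at least \<open>m / card V\<close>; the solution wanted is the projection of
  the unit vector at \<open>p\<close>.
\<close>

lemma concentrated_solution:
  fixes a :: "'i \<Rightarrow> 'v \<Rightarrow> real"
  assumes "finite I" "finite V" "card I + m \<le> card V" "m > 0"
  shows "\<exists>x. \<exists>p\<in>V. x p \<noteq> 0 \<and> (\<forall>v. v \<notin> V \<longrightarrow> x v = 0) \<and>
             (\<forall>i\<in>I. (\<Sum>v\<in>V. a i v * x v) = 0) \<and>
             real m * (\<Sum>v\<in>V. (x v)\<^sup>2) \<le> real (card V) * (x p)\<^sup>2"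
proof -
  from orthonormal_solutions[OF assms(1-3), of a] obtain B :: "nat \<Rightarrow> 'v \<Rightarrow> real" where
    B: "\<And>j v. j < m \<Longrightarrow> v \<notin> V \<Longrightarrow> B j v = 0"
       "\<And>j i. j < m \<Longrightarrow> i \<in> I \<Longrightarrow> (\<Sum>v\<in>V. a i v * B j v) = 0"
       "\<And>j l. j < m \<Longrightarrow> l < m \<Longrightarrow> (\<Sum>v\<in>V. B j v * B l v) = (if j = l then 1 else 0)"
    by blast
  define h where "h p = (\<Sum>j<m. (B j p)\<^sup>2)" for p
  define x where "x p v = (\<Sum>j<m. B j p * B j v)" for p v
  have total: "(\<Sum>p\<in>V. h p) = real m"
    unfolding h_def by (subst sum.swap) (simp add: power2_eq_square B(3))
  have "V \<noteq> {}" using assms by auto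
  have "\<exists>p\<in>V. real m \<le> real (card V) * h p"
  proof (rule ccontr)
    assume "\<not> ?thesis"
    then have "(\<Sum>p\<in>V. real (card V) * h p) < (\<Sum>p\<in>V. real m)"
      using assms(2) \<open>V \<noteq> {}\<close> by (intro sum_strict_mono) auto
    then show False using total by (simp flip: sum_distrib_left)
  qed
  then obtain p where p: "p \<in> V" "real m \<le> real (card V) * h p" by blast
  have xp: "x p p = h p" by (simp add: x_def h_def power2_eq_square)
  have "(\<Sum>v\<in>V. (x p v)\<^sup>2) = (\<Sum>v\<in>V. \<Sum>j<m. \<Sum>l<m. B j p * B l p * (B j v * B l v))"
    by (simp add: x_def power2_eq_square sum_product algebra_simps)
  also have "\<dots> = (\<Sum>j<m. \<Sum>l<m. B j p * B l p * (\<Sum>v\<in>V. B j v * B l v))"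
    by (subst sum.swap, rule sum.cong[OF refl], subst sum.swap) (simp add: sum_distrib_left)
  also have "\<dots> = h p"
    by (simp add: B(3) h_def power2_eq_square if_distrib cong: if_cong)
  finally have norm: "(\<Sum>v\<in>V. (x p v)\<^sup>2) = h p" .
  have "h p > 0"
  proof -
    have "h p \<ge> 0" by (simp add: h_def sum_nonneg)
    moreover have "h p \<noteq> 0" using p(2) assms(4) by auto
    ultimately show ?thesis by simp
  qed
  have "(\<Sum>v\<in>V. a i v * x p v) = 0" if "i \<in> I" for i
  proof -
    have "(\<Sum>v\<in>V. a i v * x p v) = (\<Sum>j<m. B j p * (\<Sum>v\<in>V. a i v * B j v))"
      unfolding x_def sum_distrib_left by (subst sum.swap) (simp add: algebra_simps)
    then show ?thesis using B(2) that by simp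
  qed
  moreover have "real m * h p \<le> real (card V) * (h p)\<^sup>2"
    using mult_right_mono[OF p(2), of "h p"] \<open>h p > 0\<close> by (simp add: power2_eq_square)
  ultimately show ?thesis
    using p(1) \<open>h p > 0\<close> B(1) norm xp by (intro exI[of _ "x p"] bexI[of _ p]) (auto simp: x_def)
qed

lemma ramsey_power_of_two:
  assumes "finite V" "2 ^ (s + t) \<le> card V" and sym: "\<And>u v. E u v \<Longrightarrow> E v u"
  shows "(\<exists>K\<subseteq>V. card K = s \<and> (\<forall>u\<in>K. \<forall>v\<in>K. u \<noteq> v \<longrightarrow> E u v)) \<or>
         (\<exists>K\<subseteq>V. card K = t \<and> (\<forall>u\<in>K. \<forall>v\<in>K. u \<noteq> v \<longrightarrow> \<not> E u v))"
  using assms(1,2)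
proof (induction "s + t" arbitrary: s t V rule: less_induct)
  case less
  show ?case
  proof (cases "s = 0 \<or> t = 0")
    case True
    then show ?thesis by (auto intro: exI[of _ "{}"])
  next
    case False
    then obtain s' t' where st: "s = Suc s'" "t = Suc t'" by (metis not0_implies_Suc)
    have "V \<noteq> {}" using less.prems by auto
    then obtain p where p: "p \<in> V" by blast
    define A where "A = {v \<in> V - {p}. E p v}"
    define B where "B = {v \<in> V - {p}. \<not> E p v}"
    have AB: "finite A" "finite B" "A \<subseteq> V" "B \<subseteq> V" "p \<notin> A" "p \<notin> B"
      using less.prems by (auto simp: A_def B_def)
    have "A \<union> B = V - {p}" "A \<inter> B = {}" by (auto simp: A_def B_def)
    then have "card A + card B = card V - 1"
      using AB p less.prems card_Un_disjoint[of A B] by (simp add: card_Diff_singleton)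
    moreover have "2 ^ (s + t) = 2 * (2::nat) ^ (s' + t)" "(2::nat) ^ (s + t') = 2 ^ (s' + t)"
      using st by (auto simp: power_add)
    ultimately consider "2 ^ (s' + t) \<le> card A" | "2 ^ (s + t') \<le> card B"
      using less.prems(2) by linarith
    then show ?thesis
    proof cases
      case 1
      with less.hyps[of s' t A, OF _ AB(1)] st have
        "(\<exists>K\<subseteq>A. card K = s' \<and> (\<forall>u\<in>K. \<forall>v\<in>K. u \<noteq> v \<longrightarrow> E u v)) \<or>
         (\<exists>K\<subseteq>A. card K = t \<and> (\<forall>u\<in>K. \<forall>v\<in>K. u \<noteq> v \<longrightarrow> \<not> E u v))" by simp
      then consider
          K where "K \<subseteq> A" "card K = s'" "\<forall>u\<in>K. \<forall>v\<in>K. u \<noteq> v \<longrightarrow> E u v"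
        | K where "K \<subseteq> A" "card K = t" "\<forall>u\<in>K. \<forall>v\<in>K. u \<noteq> v \<longrightarrow> \<not> E u v" by blast
      then show ?thesis
      proof cases
        case (1 K)
        have "finite K" using 1 AB finite_subset by blast
        with 1 have "insert p K \<subseteq> V \<and> card (insert p K) = s \<and>
            (\<forall>u\<in>insert p K. \<forall>v\<in>insert p K. u \<noteq> v \<longrightarrow> E u v)"
          using p AB st by (auto simp: A_def card_insert_if dest: sym)
        then show ?thesis by (intro disjI1 exI[of _ "insert p K"])
      next
        case (2 K)
        then show ?thesis using AB by (intro disjI2 exI[of _ K]) auto
      qed
    next
      case 2
      with less.hyps[of s t' B, OF _ AB(2)] st have
        "(\<exists>K\<subseteq>B. card K = s \<and> (\<forall>u\<in>K. \<forall>v\<in>K. u \<noteq> v \<longrightarrow> E u v)) \<or>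
         (\<exists>K\<subseteq>B. card K = t' \<and> (\<forall>u\<in>K. \<forall>v\<in>K. u \<noteq> v \<longrightarrow> \<not> E u v))" by simp
      then consider
          K where "K \<subseteq> B" "card K = s" "\<forall>u\<in>K. \<forall>v\<in>K. u \<noteq> v \<longrightarrow> E u v"
        | K where "K \<subseteq> B" "card K = t'" "\<forall>u\<in>K. \<forall>v\<in>K. u \<noteq> v \<longrightarrow> \<not> E u v" by blast
      then show ?thesis
      proof cases
        case (2 K)
        have "finite K" using 2 AB finite_subset by blast
        with 2 have "insert p K \<subseteq> V \<and> card (insert p K) = t \<and>
            (\<forall>u\<in>insert p K. \<forall>v\<in>insert p K. u \<noteq> v \<longrightarrow> \<not> E u v)"
          using p AB st by (auto simp: B_def card_insert_if dest: sym)
        then show ?thesis by (intro disjI2 exI[of _ "insert p K"])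
      next
        case (1 K)
        then show ?thesis using AB by (intro disjI1 exI[of _ K]) auto
      qed
    qed
  qed
qed

section \<open>The adjacency operator of a finite graph\<close>

locale finite_graph =
  fixes V :: "'a set" and E :: "'a \<Rightarrow> 'a \<Rightarrow> bool"
  assumes fin: "finite V"
    and sym: "E u v \<Longrightarrow> E v u"
    and irrefl: "\<not> E u u"
    and verts: "E u v \<Longrightarrow> u \<in> V"
begin

lemma verts2: "E u v \<Longrightarrow> v \<in> V"
  using sym verts by blast

definition ip :: "('a \<Rightarrow> real) \<Rightarrow> ('a \<Rightarrow> real) \<Rightarrow> real" where
  "ip x y = (\<Sum>v\<in>V. x v * y v)"

text \<open>
  The adjacency operator of the induced subgraph on \<open>H\<close>, as an operator on functions on all
  vertices.  The condition is placed inside the sum over \<open>V\<close> so that self-adjointness is a swap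
  of sums.
\<close>

definition adj :: "'a set \<Rightarrow> ('a \<Rightarrow> real) \<Rightarrow> 'a \<Rightarrow> real" where
  "adj H x u = (\<Sum>w\<in>V. if E u w \<and> u \<in> H \<and> w \<in> H then x w else 0)"

definition delta :: "'a \<Rightarrow> 'a \<Rightarrow> real" where
  "delta u v = (if v = u then 1 else 0)"

lemma ip_commute: "ip x y = ip y x"
  by (simp add: ip_def mult.commute)

lemma ip_add_left: "ip (\<lambda>v. x v + y v) z = ip x z + ip y z"
  and ip_add_right: "ip z (\<lambda>v. x v + y v) = ip z x + ip z y"
  and ip_diff_left: "ip (\<lambda>v. x v - y v) z = ip x z - ip y z"
  and ip_diff_right: "ip z (\<lambda>v. x v - y v) = ip z x - ip z y"
  and ip_scale_left: "ip (\<lambda>v. a * x v) z = a * ip x z"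
  and ip_scale_right: "ip z (\<lambda>v. a * x v) = a * ip z x"
  by (simp_all add: ip_def algebra_simps sum.distrib sum_subtractf sum_distrib_left)

lemmas ip_linear = ip_add_left ip_add_right ip_diff_left ip_diff_right ip_scale_left ip_scale_right

lemma ip_nonneg: "0 \<le> ip x x"
  by (simp add: ip_def sum_nonneg)

lemma ip_eq_0_iff: "ip x x = 0 \<longleftrightarrow> (\<forall>v\<in>V. x v = 0)"
  using fin by (simp add: ip_def sum_nonneg_eq_0_iff)

lemma ip_pos: "v \<in> V \<Longrightarrow> x v \<noteq> 0 \<Longrightarrow> 0 < ip x x"
  using ip_nonneg[of x] ip_eq_0_iff[of x] by fastforce

lemma ip_delta: "v \<in> V \<Longrightarrow> ip (delta v) x = x v"
  using fin by (simp add: ip_def delta_def if_distrib[of "\<lambda>a. a * _"] cong: if_cong)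

lemma ip_mono:
  "(\<And>v. 0 \<le> x v) \<Longrightarrow> (\<And>v. x v \<le> x' v) \<Longrightarrow> (\<And>v. 0 \<le> y v) \<Longrightarrow> (\<And>v. y v \<le> y' v)
    \<Longrightarrow> ip x y \<le> ip x' y'"
  unfolding ip_def by (intro sum_mono mult_mono) (auto intro: order_trans)

lemma ip_Cauchy_Schwarz: "(ip x y)\<^sup>2 \<le> ip x x * ip y y"
  using Cauchy_Schwarz_ineq_sum[of x y V] by (simp add: ip_def power2_eq_square)

lemma adj_outside: "u \<notin> H \<Longrightarrow> adj H x u = 0"
  by (simp add: adj_def)

lemma adj_add: "adj H (\<lambda>v. x v + y v) = (\<lambda>u. adj H x u + adj H y u)"
  and adj_diff: "adj H (\<lambda>v. x v - y v) = (\<lambda>u. adj H x u - adj H y u)"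
  and adj_scale: "adj H (\<lambda>v. a * x v) = (\<lambda>u. a * adj H x u)"
  unfolding adj_def sum_distrib_left fun_eq_iff
  by (simp_all add: sum.distrib[symmetric] sum_subtractf[symmetric] cong: sum.cong if_cong)
     (auto intro!: sum.cong)

lemmas adj_linear = adj_add adj_diff adj_scale

lemma adj_sum: "finite S \<Longrightarrow> adj H (\<lambda>v. \<Sum>i\<in>S. c i * f i v) u = (\<Sum>i\<in>S. c i * adj H (f i) u)"
  by (induction S rule: finite_induct) (simp_all add: adj_linear, simp add: adj_def)

lemma adj_self_adjoint: "ip (adj H x) y = ip x (adj H y)"
proof -
  have "ip (adj H x) y = (\<Sum>u\<in>V. \<Sum>w\<in>V. if E u w \<and> u \<in> H \<and> w \<in> H then x w * y u else 0)"
    unfolding ip_def adj_def sum_distrib_right by (intro sum.cong refl) auto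
  also have "\<dots> = (\<Sum>w\<in>V. \<Sum>u\<in>V. if E u w \<and> u \<in> H \<and> w \<in> H then x w * y u else 0)"
    by (rule sum.swap)
  also have "\<dots> = ip x (adj H y)"
    unfolding ip_def adj_def sum_distrib_left by (intro sum.cong refl) (auto dest: sym)
  finally show ?thesis .
qed

lemma adj_nonneg: "(\<And>v. 0 \<le> x v) \<Longrightarrow> 0 \<le> adj H x u"
  unfolding adj_def by (intro sum_nonneg) auto

lemma adj_mono:
  "(\<And>v. 0 \<le> x v) \<Longrightarrow> (\<And>v. x v \<le> y v) \<Longrightarrow> H \<subseteq> K \<Longrightarrow> adj H x u \<le> adj K y u"
  unfolding adj_def by (intro sum_mono) (auto intro: order_trans)

lemma adj_abs: "\<bar>adj H x u\<bar> \<le> adj H (\<lambda>v. \<bar>x v\<bar>) u"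
  unfolding adj_def by (rule order_trans[OF sum_abs]) (auto intro!: sum_mono)

lemma adj_ge_neighbour:
  assumes "E u w" "u \<in> H" "w \<in> H" "\<And>v. 0 \<le> x v"
  shows "x w \<le> adj H x u"
proof -
  have "x w = (\<Sum>v\<in>V. if v = w then x w else 0)" using fin verts2[OF assms(1)] by simp
  also have "\<dots> \<le> adj H x u" unfolding adj_def by (intro sum_mono) (use assms in auto)
  finally show ?thesis .
qed

lemma abs_form_le: "\<bar>ip (adj H x) x\<bar> \<le> ip (adj H (\<lambda>v. \<bar>x v\<bar>)) (\<lambda>v. \<bar>x v\<bar>)"
proof -
  have "\<bar>ip (adj H x) x\<bar> \<le> (\<Sum>v\<in>V. \<bar>adj H x v * x v\<bar>)" unfolding ip_def by (rule sum_abs)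
  also have "\<dots> \<le> ip (adj H (\<lambda>v. \<bar>x v\<bar>)) (\<lambda>v. \<bar>x v\<bar>)"
    unfolding ip_def abs_mult by (intro sum_mono mult_right_mono adj_abs) auto
  finally show ?thesis .
qed

lemma ip_abs: "ip (\<lambda>v. \<bar>x v\<bar>) (\<lambda>v. \<bar>x v\<bar>) = ip x x"
  by (simp add: ip_def)

text \<open>
  A symmetric operator with nonnegative entries whose form is at most \<open>c\<close> times the square norm
  has operator norm at most \<open>c\<close>.  The localised version only tests vectors supported in \<open>S\<close>,
  hence the assumption that \<open>adj V x\<close> stays in \<open>S\<close>.
\<close>

lemma norm_adj_le:
  assumes form: "\<And>z. (\<And>v. v \<notin> S \<Longrightarrow> z v = 0) \<Longrightarrow> ip (adj V z) z \<le> c * ip z z"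
    and c: "c > 0"
    and x: "\<And>v. v \<notin> S \<Longrightarrow> x v = 0" and Ax: "\<And>v. v \<notin> S \<Longrightarrow> adj V x v = 0"
  shows "ip (adj V x) (adj V x) \<le> c\<^sup>2 * ip x x"
proof -
  define y where "y = adj V x"
  have bound: "\<bar>ip (adj V z) z\<bar> \<le> c * ip z z" if "\<And>v. v \<notin> S \<Longrightarrow> z v = 0" for z
    using abs_form_le[of V z] form[of "\<lambda>v. \<bar>z v\<bar>"] that ip_abs[of z] by fastforce
  \<comment> \<open>Polarisation.  The weight \<open>c\<close> of \<open>x\<close> is the one for which the final estimate
    needs no square roots.\<close>
  let ?p = "\<lambda>v. c * x v + y v" and ?q = "\<lambda>v. c * x v - y v"
  have "ip (adj V ?p) ?p - ip (adj V ?q) ?q = 4 * c * ip y y"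
    using adj_self_adjoint[of V x y] adj_self_adjoint[of V y x]
    by (simp add: adj_linear ip_linear flip: y_def)
  moreover have "ip (adj V ?p) ?p - ip (adj V ?q) ?q \<le> c * ip ?p ?p + c * ip ?q ?q"
    using bound[of ?p] bound[of ?q] x Ax by (simp add: y_def abs_le_iff)
  moreover have "c * ip ?p ?p + c * ip ?q ?q = 2 * c * (c\<^sup>2 * ip x x + ip y y)"
    by (simp add: ip_linear ip_commute[of y x] power2_eq_square algebra_simps)
  ultimately have "2 * c * ip y y \<le> 2 * c * (c\<^sup>2 * ip x x)" by (simp add: algebra_simps)
  then show ?thesis using c by (simp add: y_def)
qed

section \<open>Balls, components and sparse nets\<close>

primrec ball :: "'a \<Rightarrow> nat \<Rightarrow> 'a set" where
  "ball v 0 = {v}"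
| "ball v (Suc n) = ball v n \<union> {w. \<exists>z\<in>ball v n. E z w}"

definition component :: "'a \<Rightarrow> 'a set" where
  "component v = (\<Union>n. ball v n)"

lemma ball_subset: "v \<in> V \<Longrightarrow> ball v n \<subseteq> V"
  by (induction n) (use verts2 in auto)

lemma ball_self: "v \<in> ball v n"
  by (induction n) auto

lemma ball_mono: "m \<le> n \<Longrightarrow> ball v m \<subseteq> ball v n"
  by (induction n) (auto simp: le_Suc_eq)

lemma ball_trans: "u \<in> ball v n \<Longrightarrow> w \<in> ball u m \<Longrightarrow> w \<in> ball v (n + m)"
  by (induction m arbitrary: w) auto

lemma ball_sym: "w \<in> ball v n \<Longrightarrow> v \<in> ball w n"
proof (induction n arbitrary: w)
  case (Suc n)
  show ?case
  proof (cases "w \<in> ball v n")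
    case True
    then show ?thesis using Suc.IH ball_mono[of n "Suc n" w] by auto
  next
    case False
    then obtain z where z: "z \<in> ball v n" "E z w" using Suc.prems by auto
    then have "z \<in> ball w 1" using sym by auto
    then show ?thesis using Suc.IH[OF z(1)] ball_trans[of z w 1 v n] by simp
  qed
qed simp

lemma component_subset: "v \<in> V \<Longrightarrow> component v \<subseteq> V"
  using ball_subset by (auto simp: component_def)

lemma component_self: "v \<in> component v"
  using ball_self by (auto simp: component_def)

lemma component_closed:
  assumes "E u w" shows "u \<in> component v \<longleftrightarrow> w \<in> component v"
proof -
  have "w \<in> component v" if "u \<in> component v" "E u w" for u w
  proof -
    from that(1) obtain n where "u \<in> ball v n" by (auto simp: component_def)
    then have "w \<in> ball v (Suc n)" using that by auto
    then show ?thesis unfolding component_def by blast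
  qed
  then show ?thesis using assms sym by blast
qed

lemma component_connected:
  assumes "w \<in> component v" "u \<in> component v"
  shows "w \<in> component u"
proof -
  obtain m n where "w \<in> ball v m" "u \<in> ball v n" using assms by (auto simp: component_def)
  then have "w \<in> ball u (n + m)" using ball_sym ball_trans by blast
  then show ?thesis unfolding component_def by blast
qed

lemma component_eq: "u \<in> component v \<Longrightarrow> component u = component v"
proof -
  assume u: "u \<in> component v"
  then have "v \<in> component u" using component_connected component_self by blast
  then show ?thesis using u component_connected by blast
qed

lemma closed_set_component:
  assumes "v \<in> X" "\<And>u w. E u w \<Longrightarrow> u \<in> X \<Longrightarrow> w \<in> X"
  shows "component v \<subseteq> X"
proof -
  have "ball v n \<subseteq> X" for n by (induction n) (use assms in auto)
  then show ?thesis by (auto simp: component_def)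
qed

lemma card_ball_le:
  assumes deg: "\<And>u. u \<in> V \<Longrightarrow> card {w. E u w} \<le> D" and v: "v \<in> V"
  shows "card (ball v n) \<le> (D + 1) ^ n"
proof (induction n)
  case (Suc n)
  have finb: "finite (ball v n)" using ball_subset[OF v] fin finite_subset by blast
  have "ball v (Suc n) = ball v n \<union> (\<Union>z\<in>ball v n. {w. E z w})" by auto
  then have "card (ball v (Suc n)) \<le> card (ball v n) + card (\<Union>z\<in>ball v n. {w. E z w})"
    by (simp add: card_Un_le)
  also have "card (\<Union>z\<in>ball v n. {w. E z w}) \<le> (\<Sum>z\<in>ball v n. card {w. E z w})"
    using finb by (rule card_UN_le)
  also have "\<dots> \<le> (\<Sum>z\<in>ball v n. D)" using deg ball_subset[OF v] by (intro sum_mono) auto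
  finally have "card (ball v (Suc n)) \<le> (D + 1) * card (ball v n)"
    by (simp add: algebra_simps)
  also have "\<dots> \<le> (D + 1) * (D + 1) ^ n" using Suc.IH by (rule mult_le_mono2)
  finally show ?case by simp
qed simp

text \<open>
  Sort the component by distance from \<open>v\<close> modulo \<open>r + 1\<close>.  Along a shortest path back to
  \<open>v\<close> every residue occurs within \<open>r\<close> steps, so the smallest residue class, together with
  \<open>v\<close> itself for the vertices close to \<open>v\<close>, is a net.
\<close>

lemma sparse_net:
  assumes v: "v \<in> V"
  shows "\<exists>R\<subseteq>component v. (r + 1) * card R \<le> card (component v) + (r + 1) \<and>
           (\<forall>u\<in>component v. \<exists>w\<in>R. w \<in> ball u r)"
proof -
  define C where "C = component v"
  have finC: "finite C" using component_subset[OF v] fin finite_subset by (auto simp: C_def)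
  define dist where "dist u = (LEAST n. u \<in> ball v n)" for u
  have dist_in: "u \<in> ball v (dist u)" if "u \<in> C" for u
    using that unfolding dist_def C_def component_def by (auto intro: LeastI)
  have dist_le: "dist u \<le> n" if "u \<in> ball v n" for u n
    unfolding dist_def using that by (rule Least_le)
  have ancestor: "\<exists>w\<in>C. w \<in> ball u n \<and> dist w = dist u - n" if "u \<in> C" "n \<le> dist u" for u n
    using that(2)
  proof (induction n)
    case 0
    then show ?case using that by auto
  next
    case (Suc n)
    then obtain w where w: "w \<in> C" "w \<in> ball u n" "dist w = dist u - n" by auto
    then have "dist w = Suc (dist u - Suc n)" using Suc.prems by simp
    moreover define m where "m = dist u - Suc n"
    ultimately have m: "dist w = Suc m" by simp
    then have "w \<in> ball v (Suc m)" "w \<notin> ball v m"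
      using dist_in[OF w(1)] dist_le[of w m] by auto
    then obtain z where z: "z \<in> ball v m" "E z w" by auto
    have "dist z = m"
    proof (rule ccontr)
      assume "dist z \<noteq> m"
      moreover have zC: "z \<in> C" using z unfolding C_def component_def by blast
      ultimately have "dist z \<le> m - 1" "m \<noteq> 0" using dist_le[OF z(1)] by auto
      then have "z \<in> ball v (m - 1)" using dist_in[OF zC] ball_mono[of "dist z" "m - 1" v] by blast
      then have "w \<in> ball v (Suc (m - 1))" using z by auto
      then show False using \<open>m \<noteq> 0\<close> \<open>w \<notin> ball v m\<close> by simp
    qed
    moreover have "z \<in> C" using z unfolding C_def component_def by blast
    moreover have "z \<in> ball u (Suc n)" using w(2) z(2) sym by auto
    ultimately show ?case using m_def by blast
  qed
  define L where "L i = {u \<in> C. dist u mod (r + 1) = i}" for i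
  have "(\<Sum>i<r + 1. card (L i)) = card (\<Union>i<r + 1. L i)"
    using finC by (subst card_UN_disjoint) (auto simp: L_def)
  also have "(\<Union>i<r + 1. L i) = C" by (auto simp: L_def)
  finally have total: "(\<Sum>i<r + 1. card (L i)) = card C" .
  have "\<exists>i<r + 1. (r + 1) * card (L i) \<le> card C"
  proof (rule ccontr)
    assume "\<not> ?thesis"
    then have "(\<Sum>i<r + 1. card C) < (\<Sum>i<r + 1. (r + 1) * card (L i))"
      by (intro sum_strict_mono) (auto simp: not_le lessThan_empty_iff)
    then show False using total by (simp only: sum_distrib_left[symmetric]) simp
  qed
  then obtain i where i: "i < r + 1" "(r + 1) * card (L i) \<le> card C" by blast
  have vC: "v \<in> C" using component_self by (simp add: C_def)
  have finL: "finite (L i)" using finC by (simp add: L_def)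
  have "\<exists>w\<in>insert v (L i). w \<in> ball u r" if uC: "u \<in> C" for u
  proof (cases "dist u < i")
    case True
    have "v \<in> ball u (dist u)" using ball_sym[OF dist_in[OF that]] .
    then show ?thesis using ball_mono[of "dist u" r u] True i by auto
  next
    case False
    define n where "n = (dist u - i) mod (r + 1)"
    have "n \<le> dist u - i" unfolding n_def by (rule mod_less_eq_dividend)
    then have "n \<le> dist u" by simp
    then obtain w where w: "w \<in> C" "w \<in> ball u n" "dist w = dist u - n"
      using ancestor[OF uC] by blast
    define q where "q = (dist u - i) div (r + 1)"
    have "dist u - i = q * (r + 1) + n" by (simp only: q_def n_def div_mult_mod_eq)
    then have "dist u - n = i + q * (r + 1)" using False by linarith
    then have "dist w mod (r + 1) = i" using w(3) i(1) by (simp only: mod_mult_self1 mod_less)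
    then have "w \<in> L i" using w by (simp add: L_def)
    moreover have "n \<le> r" unfolding n_def by (simp add: less_Suc_eq_le[symmetric])
    ultimately show ?thesis using w(2) ball_mono[of n r u] by auto
  qed
  moreover have "(r + 1) * card (insert v (L i)) \<le> card C + (r + 1)"
  proof -
    have "(r + 1) * card (insert v (L i)) \<le> (r + 1) * (card (L i) + 1)"
      using finL by (intro mult_le_mono2) (simp add: card_insert_if)
    then show ?thesis using i(2) by (simp add: algebra_simps)
  qed
  moreover have "insert v (L i) \<subseteq> C" using vC by (auto simp: L_def)
  ultimately show ?thesis unfolding C_def by blast
qed

section \<open>Closed walks after removing a net\<close>

lemma adj_pow_nonneg: "(\<And>v. 0 \<le> x v) \<Longrightarrow> 0 \<le> (adj H ^^ n) x u"
  by (induction n arbitrary: u) (auto intro: adj_nonneg)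

lemma adj_pow_mono:
  "(\<And>v. 0 \<le> x v) \<Longrightarrow> H \<subseteq> K \<Longrightarrow> (adj H ^^ n) x u \<le> (adj K ^^ n) x u"
  by (induction n arbitrary: u) (auto intro!: adj_mono adj_pow_nonneg)

lemma adj_pow_supported:
  "(\<And>v. v \<notin> H \<Longrightarrow> x v = 0) \<Longrightarrow> u \<notin> H \<Longrightarrow> (adj H ^^ n) x u = 0"
  by (cases n) (auto simp: adj_outside)

lemma adj_supported_ball:
  assumes "\<And>u. u \<notin> ball v n \<Longrightarrow> x u = 0" "u \<notin> ball v (Suc n)"
  shows "adj H x u = 0"
  unfolding adj_def using assms by (intro sum.neutral) (auto dest: sym)

lemma adj_pow_supported_ball:
  assumes "\<And>u. u \<notin> ball v n \<Longrightarrow> x u = 0" "u \<notin> ball v (n + m)"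
  shows "(adj H ^^ m) x u = 0"
  using assms(2)
proof (induction m arbitrary: u)
  case (Suc m)
  then show ?case using adj_supported_ball[of v "n + m" "(adj H ^^ m) x" u H] by auto
qed (use assms(1) in auto)

lemma adj_pow_sum:
  "finite S \<Longrightarrow> (adj H ^^ n) (\<lambda>v. \<Sum>i\<in>S. c i * f i v) u = (\<Sum>i\<in>S. c i * (adj H ^^ n) (f i) u)"
proof (induction n arbitrary: u)
  case (Suc n)
  then have "(adj H ^^ n) (\<lambda>v. \<Sum>i\<in>S. c i * f i v) = (\<lambda>u. \<Sum>i\<in>S. c i * (adj H ^^ n) (f i) u)"
    by blast
  then show ?case using adj_sum[OF Suc.prems] by simp
qed simp

lemma adj_pow_self_adjoint: "ip ((adj H ^^ n) x) y = ip x ((adj H ^^ n) y)"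
  by (induction n arbitrary: x y) (simp_all add: adj_self_adjoint funpow_swap1)

lemma delta_nonneg: "0 \<le> delta u v"
  by (simp add: delta_def)

lemma walk_exists:
  assumes "w \<in> ball u n"
  shows "\<exists>m\<le>n. 1 \<le> (adj V ^^ m) (delta u) w"
  using assms
proof (induction n arbitrary: w)
  case 0
  then show ?case by (simp add: delta_def)
next
  case (Suc n)
  show ?case
  proof (cases "w \<in> ball u n")
    case True
    then show ?thesis using Suc.IH le_SucI by blast
  next
    case False
    then obtain z where z: "z \<in> ball u n" "E z w" using Suc.prems by auto
    then obtain m where m: "m \<le> n" "1 \<le> (adj V ^^ m) (delta u) z" using Suc.IH by blast
    have "(adj V ^^ m) (delta u) z \<le> adj V ((adj V ^^ m) (delta u)) w"
      using z(2) sym verts verts2 by (intro adj_ge_neighbour adj_pow_nonneg delta_nonneg) blast+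
    then show ?thesis using m by (intro exI[of _ "Suc m"]) auto
  qed
qed

text \<open>
  A walk in the whole graph that leaves \<open>H\<close> is missed by the walks inside \<open>H\<close>; prolonging
  it to length exactly \<open>r\<close> keeps the surplus of at least one.
\<close>

lemma extra_walk:
  assumes HV: "H \<subseteq> V" and u: "u \<in> H" and exit: "\<not> ball u r \<subseteq> H"
  shows "\<exists>w\<in>V. (adj H ^^ r) (delta u) w + 1 \<le> (adj V ^^ r) (delta u) w"
proof -
  obtain w where w: "w \<in> ball u r" "w \<notin> H" using exit by blast
  then obtain m where m: "m \<le> r" "1 \<le> (adj V ^^ m) (delta u) w" using walk_exists by blast
  have nonneg: "0 \<le> (adj K ^^ l) (delta u) v" for K l v
    using adj_pow_nonneg delta_nonneg by blast
  have start: "(adj H ^^ m) (delta u) w + 1 \<le> (adj V ^^ m) (delta u) w"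
  proof -
    have "(adj H ^^ m) (delta u) w = 0"
      using w(2) u by (intro adj_pow_supported) (auto simp: delta_def)
    then show ?thesis using m(2) by simp
  qed
  have "m \<noteq> 0" using m(2) w(2) u by (intro notI) (auto simp: delta_def split: if_splits)
  then obtain m' where m': "m = Suc m'" by (cases m) auto
  have "\<exists>z. E w z"
  proof (rule ccontr)
    assume "\<nexists>z. E w z"
    then have "adj V ((adj V ^^ m') (delta u)) w = 0" unfolding adj_def by (intro sum.neutral) auto
    then show False using m(2) m' by simp
  qed
  then have start2: "\<exists>z. E w z" .
  have "\<exists>w'. (\<exists>z. E w' z) \<and> (adj H ^^ (m + l)) (delta u) w' + 1 \<le> (adj V ^^ (m + l)) (delta u) w'" for l
  proof (induction l)
    case 0
    then show ?case using start start2 by auto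
  next
    case (Suc l)
    then obtain w' z where w': "E w' z"
        "(adj H ^^ (m + l)) (delta u) w' + 1 \<le> (adj V ^^ (m + l)) (delta u) w'" by blast
    define p where "p = (adj V ^^ (m + l)) (delta u)"
    define q where "q = (adj H ^^ (m + l)) (delta u)"
    have "q v \<le> p v" for v unfolding p_def q_def by (intro adj_pow_mono delta_nonneg HV)
    then have pq: "0 \<le> p v - q v" for v by (simp add: algebra_simps)
    have "1 \<le> p w' - q w'" using w'(2) by (simp add: p_def q_def)
    also have "\<dots> \<le> adj V (\<lambda>v. p v - q v) z"
      using w'(1) sym verts verts2 pq by (intro adj_ge_neighbour) blast+
    also have "\<dots> = adj V p z - adj V q z" by (simp add: adj_diff)
    also have "\<dots> \<le> adj V p z - adj H q z"
      using adj_mono[of q q H V z] nonneg HV by (simp add: q_def)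
    finally show ?case using w'(1) sym by (intro exI[of _ z]) (auto simp: p_def q_def)
  qed
  from this[of "r - m"] show ?thesis using m(1) verts by auto
qed

text \<open>
  Each \<open>u\<close> in \<open>H\<close> has a closed walk of length \<open>2r\<close> that leaves \<open>H\<close>: follow a walk of
  length \<open>r\<close> as in \<open>extra_walk\<close> and return.  Hence the \<open>2r\<close>-th power of the adjacency
  matrix exceeds that of the subgraph by at least the identity on \<open>H\<close>.
\<close>

lemma adj_pow_gain:
  assumes HV: "H \<subseteq> V" and exit: "\<And>u. u \<in> H \<Longrightarrow> \<not> ball u r \<subseteq> H"
    and x: "\<And>v. v \<notin> H \<Longrightarrow> x v = 0" and x_nonneg: "\<And>v. 0 \<le> x v"
  shows "ip ((adj H ^^ r) x) ((adj H ^^ r) x) + ip x x \<le> ip ((adj V ^^ r) x) ((adj V ^^ r) x)"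
proof -
  have finH: "finite H" using HV fin finite_subset by blast
  have x_sum: "x = (\<lambda>v. \<Sum>u\<in>H. x u * delta u v)"
  proof
    fix v
    have "(\<Sum>u\<in>H. x u * delta u v) = (\<Sum>u\<in>H. if u = v then x v else 0)"
      by (intro sum.cong) (auto simp: delta_def)
    then show "x v = (\<Sum>u\<in>H. x u * delta u v)" using finH x by simp
  qed
  define F where "F K u = (adj K ^^ r) (delta u)" for K u
  have F_nonneg: "0 \<le> F K u v" for K u v
    unfolding F_def by (intro adj_pow_nonneg delta_nonneg)
  have F_mono: "F H u v \<le> F V u v" for u v
    unfolding F_def by (intro adj_pow_mono delta_nonneg HV)
  have expand: "ip ((adj K ^^ r) x) ((adj K ^^ r) x) = (\<Sum>u\<in>H. \<Sum>w\<in>H. x u * x w * ip (F K u) (F K w))" for K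
  proof -
    have "(adj K ^^ r) x = (\<lambda>v. \<Sum>u\<in>H. x u * F K u v)"
      by (subst x_sum) (simp add: adj_pow_sum[OF finH] F_def fun_eq_iff)
    then have "ip ((adj K ^^ r) x) ((adj K ^^ r) x)
        = (\<Sum>v\<in>V. \<Sum>u\<in>H. \<Sum>w\<in>H. x u * F K u v * (x w * F K w v))"
      by (simp add: ip_def sum_product)
    also have "\<dots> = (\<Sum>u\<in>H. \<Sum>w\<in>H. \<Sum>v\<in>V. x u * F K u v * (x w * F K w v))"
      by (subst sum.swap, rule sum.cong[OF refl], rule sum.swap)
    finally show ?thesis by (simp add: ip_def sum_distrib_left algebra_simps)
  qed
  have step: "ip (F H u) (F H w) + (if u = w then 1 else 0) \<le> ip (F V u) (F V w)"
    if u: "u \<in> H" and w: "w \<in> H" for u w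
  proof (cases "u = w")
    case False
    then show ?thesis using F_nonneg F_mono by (simp add: ip_mono)
  next
    case True
    obtain p where p: "p \<in> V" "F H u p + 1 \<le> F V u p"
      using extra_walk[OF HV u exit[OF u]] unfolding F_def by blast
    have "ip (F H u) (F H u) + 1 = (\<Sum>v\<in>V. F H u v * F H u v + delta p v)"
      using fin p(1) by (simp add: ip_def sum.distrib delta_def)
    also have "\<dots> \<le> ip (F V u) (F V u)" unfolding ip_def
    proof (intro sum_mono)
      fix v assume "v \<in> V"
      show "F H u v * F H u v + delta p v \<le> F V u v * F V u v"
      proof (cases "v = p")
        case True
        have "F H u p * F H u p + 1 \<le> (F H u p + 1) * (F H u p + 1)"
          using F_nonneg[of H u p] by (simp add: algebra_simps)
        also have "\<dots> \<le> F V u p * F V u p" using p(2) F_nonneg[of H u p] by (intro mult_mono) auto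
        finally show ?thesis using True by (simp add: delta_def)
      next
        case False
        then show ?thesis using F_nonneg F_mono by (simp add: delta_def mult_mono)
      qed
    qed
    finally show ?thesis using True by simp
  qed
  have "ip x x = (\<Sum>u\<in>H. x u * x u)"
    unfolding ip_def using HV fin x by (intro sum.mono_neutral_right) auto
  also have "\<dots> = (\<Sum>u\<in>H. \<Sum>w\<in>H. x u * x w * (if u = w then 1 else 0))"
    using finH by (simp add: if_distrib cong: if_cong)
  finally have "ip ((adj H ^^ r) x) ((adj H ^^ r) x) + ip x x
      = (\<Sum>u\<in>H. \<Sum>w\<in>H. x u * x w * (ip (F H u) (F H w) + (if u = w then 1 else 0)))"
    by (simp only: expand ring_distribs sum.distrib)
  also have "\<dots> \<le> ip ((adj V ^^ r) x) ((adj V ^^ r) x)"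
    unfolding expand using step x_nonneg by (intro sum_mono mult_left_mono) auto
  finally show ?thesis .
qed

lemma norm_adj_pow_le:
  assumes form: "\<And>z. (\<And>u. u \<notin> ball v (n + r) \<Longrightarrow> z u = 0) \<Longrightarrow> ip (adj V z) z \<le> c * ip z z"
    and c: "c > 0" and x: "\<And>u. u \<notin> ball v n \<Longrightarrow> x u = 0"
  shows "ip ((adj V ^^ r) x) ((adj V ^^ r) x) \<le> c ^ (2 * r) * ip x x"
proof -
  have "ip ((adj V ^^ i) x) ((adj V ^^ i) x) \<le> c ^ (2 * i) * ip x x" if "i \<le> r" for i
    using that
  proof (induction i)
    case (Suc i)
    define y where "y = (adj V ^^ i) x"
    have supp: "y u = 0" "adj V y u = 0" if "u \<notin> ball v (n + r)" for u
      using that Suc.prems adj_pow_supported_ball[of v n x u i V]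
        adj_pow_supported_ball[of v n x u "Suc i" V] x
        ball_mono[of "n + i" "n + r" v] ball_mono[of "n + Suc i" "n + r" v]
      by (auto simp: y_def)
    have "ip (adj V y) (adj V y) \<le> c\<^sup>2 * ip y y"
      by (rule norm_adj_le[OF form c supp])
    also have "\<dots> \<le> c\<^sup>2 * (c ^ (2 * i) * ip x x)"
      using Suc by (intro mult_left_mono) (auto simp: y_def)
    finally show ?case by (simp add: y_def power2_eq_square mult.assoc)
  qed simp
  then show ?thesis by blast
qed

text \<open>
  Iterating the gain: if the form on the ball of radius \<open>rj\<close> around \<open>v\<close> is bounded by \<open>c\<close>,
  every block of \<open>r\<close> steps inside \<open>H\<close> multiplies the square norm by at most
  \<open>c^(2r) - 1\<close> instead of \<open>c^(2r)\<close>.  The walk never leaves the ball, so no global bound on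
  the form is needed.
\<close>

lemma local_walk_bound:
  assumes HV: "H \<subseteq> V" and exit: "\<And>u. u \<in> H \<Longrightarrow> \<not> ball u r \<subseteq> H" and v: "v \<in> H"
    and form: "\<And>z. (\<And>u. u \<notin> ball v (r * j) \<Longrightarrow> z u = 0) \<Longrightarrow> ip (adj V z) z \<le> c * ip z z"
    and c: "c \<ge> 1"
  shows "ip ((adj H ^^ (r * j)) (delta v)) ((adj H ^^ (r * j)) (delta v)) \<le> (c ^ (2 * r) - 1) ^ j"
proof -
  have "ip ((adj H ^^ (r * i)) (delta v)) ((adj H ^^ (r * i)) (delta v)) \<le> (c ^ (2 * r) - 1) ^ i"
    if "i \<le> j" for i
    using that
  proof (induction i)
    case 0
    then show ?case using ip_delta[of v "delta v"] v HV delta_def[of v v] by auto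
  next
    case (Suc i)
    define x where "x = (adj H ^^ (r * i)) (delta v)"
    have x_ball: "x u = 0" if "u \<notin> ball v (r * i)" for u
      using adj_pow_supported_ball[of v 0 "delta v" u "r * i" H] that by (simp add: x_def delta_def)
    have x_H: "x u = 0" if "u \<notin> H" for u
      unfolding x_def using that v by (intro adj_pow_supported) (auto simp: delta_def)
    have x_nonneg: "0 \<le> x u" for u
      unfolding x_def by (intro adj_pow_nonneg delta_nonneg)
    have "r * i + r \<le> r * j" using mult_le_mono2[OF Suc.prems, of r] by simp
    then have form': "ip (adj V z) z \<le> c * ip z z"
      if "\<And>u. u \<notin> ball v (r * i + r) \<Longrightarrow> z u = 0" for z
      using form[of z] that ball_mono[of "r * i + r" "r * j" v] by blast
    have "ip ((adj H ^^ r) x) ((adj H ^^ r) x) + ip x x \<le> ip ((adj V ^^ r) x) ((adj V ^^ r) x)"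
      by (rule adj_pow_gain[OF HV exit x_H x_nonneg])
    also have "\<dots> \<le> c ^ (2 * r) * ip x x"
      by (rule norm_adj_pow_le[OF form' _ x_ball]) (use c in auto)
    finally have "ip ((adj H ^^ r) x) ((adj H ^^ r) x) \<le> (c ^ (2 * r) - 1) * ip x x"
      by (simp add: algebra_simps)
    also have "\<dots> \<le> (c ^ (2 * r) - 1) * (c ^ (2 * r) - 1) ^ i"
      using Suc c by (intro mult_left_mono) (auto simp: x_def)
    finally show ?case by (simp add: x_def funpow_add)
  qed
  then show ?thesis by blast
qed

text \<open>
  Since \<open>w\<close> lives on \<open>H\<close>, it is an eigenvector of the subgraph too, and
  \<open>c^s w(v)\<close> is the inner product of \<open>w\<close> with the walk counts from \<open>v\<close>; the bound is
  the Cauchy--Schwarz inequality.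
\<close>

lemma eigenvector_entry_bound:
  assumes HV: "H \<subseteq> V" and v: "v \<in> H"
    and w: "\<And>u. u \<notin> H \<Longrightarrow> w u = 0" and eig: "\<And>u. u \<in> V \<Longrightarrow> adj V w u = c * w u"
  shows "c ^ (2 * s) * (w v)\<^sup>2 \<le> ip ((adj H ^^ s) (delta v)) ((adj H ^^ s) (delta v)) * ip w w"
proof -
  have adjH: "adj H w = (\<lambda>u. c * w u)"
  proof
    fix u
    show "adj H w u = c * w u"
    proof (cases "u \<in> H")
      case True
      have "adj H w u = adj V w u"
        unfolding adj_def using True HV w by (intro sum.cong) auto
      then show ?thesis using eig True HV by auto
    qed (simp add: adj_outside w)
  qed
  have pow: "(adj H ^^ s) w = (\<lambda>u. c ^ s * w u)"
    by (induction s) (simp_all add: adj_scale adjH mult.assoc mult.left_commute)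
  have "c ^ s * w v = ip (delta v) ((adj H ^^ s) w)"
    using ip_delta[of v] v HV by (auto simp: pow)
  also have "\<dots> = ip ((adj H ^^ s) (delta v)) w" by (simp add: adj_pow_self_adjoint)
  finally have "(c ^ s * w v)\<^sup>2 \<le> ip ((adj H ^^ s) (delta v)) ((adj H ^^ s) (delta v)) * ip w w"
    using ip_Cauchy_Schwarz by simp
  then show ?thesis by (simp add: power_mult_distrib power_mult mult.commute[of 2 s])
qed

section \<open>Extremal vectors of the adjacency form\<close>

lemma form_split:
  assumes closed: "\<And>u w. E u w \<Longrightarrow> u \<in> X \<Longrightarrow> w \<in> X"
  shows "ip (adj V x) x = ip (adj V (\<lambda>v. if v \<in> X then x v else 0)) (\<lambda>v. if v \<in> X then x v else 0)
     + ip (adj V (\<lambda>v. if v \<in> X then 0 else x v)) (\<lambda>v. if v \<in> X then 0 else x v)"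
proof -
  have "u \<in> X \<longleftrightarrow> w \<in> X" if "E u w" for u w using closed that sym by blast
  then show ?thesis
    unfolding ip_def adj_def sum_distrib_right sum.distrib[symmetric]
    by (intro sum.cong refl) (auto split: if_splits)
qed

lemma ip_split:
  "ip x x = ip (\<lambda>v. if v \<in> X then x v else 0) (\<lambda>v. if v \<in> X then x v else 0)
     + ip (\<lambda>v. if v \<in> X then 0 else x v) (\<lambda>v. if v \<in> X then 0 else x v)"
  unfolding ip_def sum.distrib[symmetric] by (intro sum.cong) auto

text \<open>
  The form is additive over components, so if it exceeds \<open>c\<close> times the square norm, it does so on
  a single component.  The induction splits off one component of a union of components at a time.
\<close>

lemma component_exceeding_form:
  assumes "c * ip x x < ip (adj V x) x"
  obtains v y where "v \<in> V" "\<And>u. u \<notin> component v \<Longrightarrow> y u = 0" "c * ip y y < ip (adj V y) y"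
proof -
  have claim: "\<exists>v\<in>V. \<exists>y. (\<forall>u. u \<notin> component v \<longrightarrow> y u = 0) \<and> c * ip y y < ip (adj V y) y"
    if "finite X" "X \<subseteq> V" "\<And>u w. E u w \<Longrightarrow> u \<in> X \<Longrightarrow> w \<in> X"
      "\<And>u. u \<notin> X \<Longrightarrow> x u = 0" "c * ip x x < ip (adj V x) x" for X x
    using that
  proof (induction X arbitrary: x rule: finite_psubset_induct)
    case (psubset X)
    have "X \<noteq> {}"
    proof
      assume "X = {}"
      then have "ip x x = 0" "ip (adj V x) x = 0" using psubset.prems by (auto simp: ip_def)
      then show False using psubset.prems by simp
    qed
    then obtain v where v: "v \<in> X" by blast
    define C where "C = component v"
    have CX: "C \<subseteq> X" unfolding C_def by (rule closed_set_component[OF v psubset.prems(2)])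
    define y where "y = (\<lambda>u. if u \<in> C then x u else 0)"
    define z where "z = (\<lambda>u. if u \<in> C then 0 else x u)"
    have closedC: "w \<in> C" if "E u w" "u \<in> C" for u w
      using component_closed[OF that(1)] that(2) by (simp add: C_def)
    have "ip (adj V x) x = ip (adj V y) y + ip (adj V z) z" "ip x x = ip y y + ip z z"
      unfolding y_def z_def using form_split[of C x] ip_split[of x C] closedC by blast+
    with psubset.prems(4) consider "c * ip y y < ip (adj V y) y" | "c * ip z z < ip (adj V z) z"
      by (fastforce simp: algebra_simps)
    then show ?case
    proof cases
      case 1
      then show ?thesis using v psubset.prems(1)
        by (intro bexI[of _ v] exI[of _ y]) (auto simp: y_def C_def)
    next
      case 2
      have "X - C \<subset> X" using v CX component_self by (auto simp: C_def)
      moreover have "w \<in> X - C" if "E u w" "u \<in> X - C" for u w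
        using that psubset.prems(2) closedC sym by blast
      moreover have "z u = 0" if "u \<notin> X - C" for u
        using that psubset.prems(3) by (auto simp: z_def)
      ultimately show ?thesis using psubset.IH[of "X - C" z] psubset.prems(1) 2 by blast
    qed
  qed
  define x' where "x' = (\<lambda>u. if u \<in> V then x u else 0)"
  have "adj V x' = adj V x" unfolding adj_def x'_def by (intro ext sum.cong) auto
  then have "ip (adj V x') x' = ip (adj V x) x" "ip x' x' = ip x x"
    by (auto simp: ip_def x'_def)
  then have "c * ip x' x' < ip (adj V x') x'" using assms by simp
  moreover have "x' u = 0" if "u \<notin> V" for u using that by (simp add: x'_def)
  ultimately have "\<exists>v\<in>V. \<exists>y. (\<forall>u. u \<notin> component v \<longrightarrow> y u = 0) \<and> c * ip y y < ip (adj V y) y"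
    using claim[OF fin order_refl, of x'] verts2 by blast
  then show ?thesis using that by blast
qed

text \<open>
  A vector at which the nonnegative form \<open>c |x|^2 - <A x, x>\<close> vanishes is in the kernel of
  \<open>c - A\<close>: perturb it in the direction of \<open>c x - A x\<close> and let the linear term win.
\<close>

lemma form_maximiser_eigenvector:
  assumes form: "\<And>z. ip (adj V z) z \<le> c * ip z z" and x: "ip (adj V x) x = c * ip x x"
    and u: "u \<in> V"
  shows "adj V x u = c * x u"
proof -
  define y where "y = (\<lambda>v. c * x v - adj V x v)"
  define n where "n = ip y y"
  define q where "q = c * ip y y - ip (adj V y) y"
  have "q \<ge> 0" using form[of y] by (simp add: q_def)
  have quad: "0 \<le> 2 * t * n + t\<^sup>2 * q" for t
  proof -
    have "0 \<le> c * ip (\<lambda>v. x v + t * y v) (\<lambda>v. x v + t * y v)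
        - ip (adj V (\<lambda>v. x v + t * y v)) (\<lambda>v. x v + t * y v)"
      using form by simp
    also have "\<dots> = 2 * t * (c * ip x y - ip (adj V x) y) + t\<^sup>2 * q"
      using x adj_self_adjoint[of V y x]
      by (simp add: adj_linear ip_linear q_def ip_commute[of y x] ip_commute[of y "adj V x"]
          power2_eq_square algebra_simps)
    also have "c * ip x y - ip (adj V x) y = ip (\<lambda>v. c * x v - adj V x v) y"
      by (simp only: ip_linear)
    also have "\<dots> = n" by (simp add: n_def y_def)
    finally show ?thesis .
  qed
  have "n = 0"
  proof (rule ccontr)
    assume "n \<noteq> 0"
    then have "n > 0" using ip_nonneg[of y] by (simp add: n_def)
    \<comment> \<open>For this \<open>t\<close> the linear term \<open>2 t n\<close> is negative and outweighs the quadratic one.\<close>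
    define t where "t = - n / (q + 1)"
    have n_eq: "n = - t * (q + 1)" using \<open>q \<ge> 0\<close> by (simp add: t_def)
    have "2 * t * n + t\<^sup>2 * q = - (t\<^sup>2 * (q + 2))"
      unfolding n_eq by (simp add: power2_eq_square algebra_simps)
    moreover have "t \<noteq> 0" using \<open>n \<noteq> 0\<close> \<open>q \<ge> 0\<close> by (simp add: t_def)
    then have "0 < t\<^sup>2 * (q + 2)" using \<open>q \<ge> 0\<close> by (intro mult_pos_pos) auto
    ultimately show False using quad[of t] by linarith
  qed
  then show ?thesis using u ip_eq_0_iff[of y] by (simp add: n_def y_def)
qed

text \<open>
  The Perron--Frobenius argument: if the eigenvector vanishes at a vertex, it vanishes at all its
  neighbours, hence on the component.
\<close>

lemma nonneg_eigenvector_positive: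
  assumes eig: "\<And>u. u \<in> V \<Longrightarrow> adj V x u = c * x u" and nonneg: "\<And>u. 0 \<le> x u"
    and v: "v \<in> V" "x v > 0" and u: "u \<in> component v"
  shows "x u > 0"
proof (rule ccontr)
  assume "\<not> x u > 0"
  then have u0: "x u = 0" using nonneg[of u] by simp
  define X where "X = {w. x w = 0}"
  have "w \<in> X" if E: "E z w" and z: "z \<in> X" for z w
  proof -
    have "x w \<le> adj V x z"
      using E nonneg verts verts2 by (intro adj_ge_neighbour) blast+
    also have "\<dots> = 0" using eig[OF verts[OF E]] z by (simp add: X_def)
    finally show ?thesis using nonneg[of w] by (simp add: X_def)
  qed
  then have "component u \<subseteq> X" using u0 by (intro closed_set_component) (auto simp: X_def)
  moreover have "v \<in> component u" using u component_connected component_self by blast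
  ultimately show False using v by (auto simp: X_def)
qed

text \<open>
  At a vertex of the component where the eigenvector is largest, the eigenvalue is at most the number
  of neighbours.
\<close>

lemma nonneg_eigenvector_component_card:
  assumes eig: "\<And>u. u \<in> V \<Longrightarrow> adj V x u = c * x u" and nonneg: "\<And>u. 0 \<le> x u"
    and v: "v \<in> V" "x v > 0"
  shows "c + 1 \<le> real (card (component v))"
proof -
  define C where "C = component v"
  have CV: "C \<subseteq> V" using component_subset[OF v(1)] by (simp add: C_def)
  have finC: "finite C" using CV fin finite_subset by blast
  have "C \<noteq> {}" using component_self by (auto simp: C_def)
  then have "Max (x ` C) \<in> x ` C" using finC by simp
  then obtain u where "u \<in> C" "x u = Max (x ` C)" by auto
  then have u: "u \<in> C" "\<And>w. w \<in> C \<Longrightarrow> x w \<le> x u" using finC by auto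
  have pos: "x u > 0"
    using nonneg_eigenvector_positive[OF eig nonneg v] u(1) by (auto simp: C_def)
  have "c * x u = adj V x u" using eig u(1) CV by auto
  also have "\<dots> \<le> (\<Sum>w\<in>V. if w \<in> C - {u} then x u else 0)"
    unfolding adj_def
  proof (intro sum_mono)
    fix w assume "w \<in> V"
    have "w \<in> C - {u}" if "E u w"
      using that u(1) component_closed[OF that] irrefl by (auto simp: C_def)
    then show "(if E u w \<and> u \<in> V \<and> w \<in> V then x w else 0) \<le> (if w \<in> C - {u} then x u else 0)"
      using u(2) pos by auto
  qed
  also have "\<dots> = (\<Sum>w\<in>C - {u}. x u)"
    using fin CV by (intro sum.mono_neutral_cong_right) auto
  also have "\<dots> = (real (card C) - 1) * x u"
  proof -
    have "1 \<le> card C" using finC u(1) by (auto simp: Suc_le_eq card_gt_0_iff)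
    then show ?thesis using finC u(1) by (simp add: card_Diff_singleton of_nat_diff)
  qed
  finally show ?thesis using pos by (simp add: C_def)
qed

lemma adj_indicator:
  "X \<subseteq> V \<Longrightarrow> adj V (indicator X) u = real (card {w \<in> X. E u w})"
proof -
  assume X: "X \<subseteq> V"
  have "adj V (indicator X) u = (\<Sum>w\<in>V. if w \<in> {w \<in> X. E u w} then 1 else 0)"
    unfolding adj_def using verts by (intro sum.cong) (auto simp: indicator_def)
  also have "\<dots> = real (card (V \<inter> {w \<in> X. E u w}))"
    using fin by (simp add: sum.If_cases)
  also have "V \<inter> {w \<in> X. E u w} = {w \<in> X. E u w}" using X by auto
  finally show ?thesis .
qed

lemma ip_indicator: "X \<subseteq> V \<Longrightarrow> ip f (indicator X) = sum f X"
  unfolding ip_def using fin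
  by (intro sum.mono_neutral_cong_right) (auto simp: indicator_def)

lemma sum_indicator_real: "X \<subseteq> V \<Longrightarrow> sum (indicator X) V = real (card X)"
  using fin by (simp add: indicator_def sum.If_cases Int_absorb1)

end

section \<open>Graphs of equiangular vectors\<close>

text \<open>
  The vectors \<open>c v\<close> in \<open>\<real>\<^sup>d\<close> are unit vectors of equiangular lines, scaled by
  \<open>sqrt ((2k-1)/2)\<close> so that their Gram matrix is \<open>(k-1) I - A + J/2\<close>.
\<close>

locale gram_graph = finite_graph V E for V :: "'a set" and E +
  fixes k d :: nat and c :: "'a \<Rightarrow> nat \<Rightarrow> real"
  assumes k: "k \<ge> 2"
    and gram: "u \<in> V \<Longrightarrow> w \<in> V \<Longrightarrow>
      (\<Sum>i<d. c u i * c w i) = (if u = w then real k - 1 else 0) - (if E u w then 1 else 0) + 1 / 2"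
begin

abbreviation lam :: real where "lam \<equiv> real k - 1"

lemma gram_apply:
  assumes "u \<in> V"
  shows "(\<Sum>i<d. c u i * (\<Sum>w\<in>V. c w i * x w)) = lam * x u - adj V x u + (\<Sum>w\<in>V. x w) / 2"
proof -
  have "(\<Sum>i<d. c u i * (\<Sum>w\<in>V. c w i * x w)) = (\<Sum>w\<in>V. (\<Sum>i<d. c u i * c w i) * x w)"
    unfolding sum_distrib_left sum_distrib_right by (subst sum.swap) (simp add: algebra_simps)
  also have "\<dots> = (\<Sum>w\<in>V. (if u = w then lam * x w else 0) - (if E u w \<and> u \<in> V \<and> w \<in> V then x w else 0) + x w / 2)"
    by (intro sum.cong refl, subst gram[OF assms]) (use assms irrefl in \<open>auto simp: ring_distribs\<close>)
  finally show ?thesis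
    using fin assms by (simp add: sum.distrib sum_subtractf adj_def sum_divide_distrib)
qed

lemma gram_form:
  "(\<Sum>i<d. (\<Sum>w\<in>V. c w i * x w)\<^sup>2) = lam * ip x x - ip (adj V x) x + (\<Sum>w\<in>V. x w)\<^sup>2 / 2"
proof -
  have "(\<Sum>i<d. (\<Sum>w\<in>V. c w i * x w)\<^sup>2) = (\<Sum>u\<in>V. x u * (\<Sum>i<d. c u i * (\<Sum>w\<in>V. c w i * x w)))"
    unfolding power2_eq_square sum_distrib_left sum_distrib_right
    by (subst sum.swap) (simp add: sum_distrib_left algebra_simps)
  also have "\<dots> = (\<Sum>u\<in>V. x u * (lam * x u - adj V x u + (\<Sum>w\<in>V. x w) / 2))"
    by (intro sum.cong) (simp_all add: gram_apply)
  finally show ?thesis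
    by (simp add: ip_def algebra_simps sum.distrib sum_subtractf sum_distrib_left power2_eq_square
        flip: sum_divide_distrib)
qed

lemma psd: "0 \<le> lam * ip x x - ip (adj V x) x + (\<Sum>w\<in>V. x w)\<^sup>2 / 2"
proof -
  have "0 \<le> (\<Sum>i<d. (\<Sum>w\<in>V. c w i * x w)\<^sup>2)" by (intro sum_nonneg zero_le_power2)
  then show ?thesis by (simp only: gram_form)
qed

lemma psd_orthogonal: "(\<Sum>w\<in>V. x w) = 0 \<Longrightarrow> ip (adj V x) x \<le> lam * ip x x"
  using psd[of x] by simp

lemma dependency_form:
  assumes "\<And>i. i < d \<Longrightarrow> (\<Sum>w\<in>V. c w i * x w) = 0"
  shows "u \<in> V \<Longrightarrow> adj V x u = lam * x u + (\<Sum>w\<in>V. x w) / 2"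
    and "ip (adj V x) x = lam * ip x x + (\<Sum>w\<in>V. x w)\<^sup>2 / 2"
proof -
  assume u: "u \<in> V"
  have "(\<Sum>i<d. c u i * (\<Sum>w\<in>V. c w i * x w)) = 0"
    by (intro sum.neutral) (simp add: assms)
  then show "adj V x u = lam * x u + (\<Sum>w\<in>V. x w) / 2" using gram_apply[OF u, of x] by linarith
next
  have "(\<Sum>i<d. (\<Sum>w\<in>V. c w i * x w)\<^sup>2) = 0"
    by (intro sum.neutral) (simp add: assms)
  then show "ip (adj V x) x = lam * ip x x + (\<Sum>w\<in>V. x w)\<^sup>2 / 2" using gram_form[of x] by linarith
qed

section \<open>Bounded degree\<close>

lemma lam_pos: "lam \<ge> 1"
  using k by simp

lemma no_large_clique:
  assumes "K \<subseteq> V" "card K = 2 * k + 1" "\<And>u v. u \<in> K \<Longrightarrow> v \<in> K \<Longrightarrow> u \<noteq> v \<Longrightarrow> E u v"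
  shows False
proof -
  have finK: "finite K" using assms(1) fin finite_subset by blast
  define n where "n = 2 * real k"
  have "card {w \<in> K. E u w} = 2 * k" if "u \<in> K" for u
  proof -
    have "{w \<in> K. E u w} = K - {u}" using assms(3) that irrefl by auto
    then show ?thesis using that finK assms(2) by simp
  qed
  then have form: "ip (adj V (indicator K)) (indicator K) = n * (n + 1)"
    using assms by (simp add: ip_indicator adj_indicator n_def)
  have norm: "ip (indicator K) (indicator K) = n + 1"
    using assms(2) ip_indicator[OF assms(1), of "indicator K"] by (simp add: n_def)
  have "0 \<le> lam * (n + 1) - n * (n + 1) + (n + 1)\<^sup>2 / 2"
    using psd[of "indicator K"] assms by (simp add: form norm sum_indicator_real n_def add.commute)
  also have "\<dots> = - (n + 1) / 2"
    by (simp add: n_def field_simps power2_eq_square)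
  finally show False by (simp add: n_def)
qed

text \<open>
  The test vector is \<open>1\<close> at \<open>v\<close>, \<open>\<lambda> / |T|\<close> on \<open>T\<close> and \<open>- k / |S|\<close> on \<open>S\<close>, where
  \<open>\<lambda> = k - 1\<close>; its coordinates sum to zero.  For \<open>T\<close> and \<open>S\<close> this large its square norm is
  below \<open>2\<close>, whereas the edges between \<open>v\<close> and \<open>T\<close> alone give the adjacency form the value
  \<open>2 \<lambda>\<close>, and the few edges between \<open>T\<close> and \<open>S\<close> cannot compensate for this.
\<close>

lemma star_test:
  assumes V: "v \<in> V" "T \<subseteq> V" "S \<subseteq> V" and disj: "T \<inter> S = {}" "v \<notin> T" "v \<notin> S"
    and T: "\<And>u w. u \<in> T \<Longrightarrow> w \<in> T \<Longrightarrow> \<not> E u w" and S: "\<And>u w. u \<in> S \<Longrightarrow> w \<in> S \<Longrightarrow> \<not> E u w"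
    and vT: "\<And>u. u \<in> T \<Longrightarrow> E v u" and vS: "\<And>u. u \<in> S \<Longrightarrow> \<not> E v u"
    and TS: "\<And>u. u \<in> T \<Longrightarrow> card {w \<in> S. E u w} \<le> D"
    and cardT: "3 * k\<^sup>2 \<le> card T" and cardS: "3 * k\<^sup>2 + 6 * k * D \<le> card S"
  shows False
proof -
  define p where "p = real (card T)"
  define q where "q = real (card S)"
  define e where "e = real D"
  have kr: "real k \<ge> 2" using k by simp
  have "real (3 * k\<^sup>2) \<le> p" using cardT unfolding p_def of_nat_le_iff .
  then have p: "3 * (real k)\<^sup>2 \<le> p" by simp
  have "real (3 * k\<^sup>2 + 6 * k * D) \<le> q" using cardS unfolding q_def of_nat_le_iff .
  then have q: "3 * (real k)\<^sup>2 + 6 * real k * e \<le> q" by (simp add: e_def)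
  have e: "e \<ge> 0" by (simp add: e_def)
  have k2: "0 < (real k)\<^sup>2" using kr by simp
  have p0: "p > 0" using p k2 by linarith
  have "0 \<le> 6 * real k * e" using e by simp
  then have q0: "q > 0" using q k2 by linarith
  define a where "a = lam / p"
  define b where "b = real k / q"
  have ab: "a * p = lam" "b * q = real k" using p0 q0 by (auto simp: a_def b_def)
  have a0: "a > 0" and b0: "b > 0" using p0 q0 kr by (auto simp: a_def b_def)
  let ?v = "indicator {v} :: 'a \<Rightarrow> real" and ?T = "indicator T :: 'a \<Rightarrow> real"
    and ?S = "indicator S :: 'a \<Rightarrow> real"
  let ?x = "\<lambda>u. (?v u + a * ?T u) - b * ?S u"
  define f where "f = ip (adj V ?S) ?T"
  have sub: "{v} \<subseteq> V" using V by simp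
  have zero: "card {w \<in> X. E u w} = 0" if "\<And>w. w \<in> X \<Longrightarrow> \<not> E u w" for X u
    using that by (simp add: card_eq_0_iff)
  have forms: "ip (adj V ?v) ?v = 0" "ip (adj V ?T) ?T = 0" "ip (adj V ?S) ?S = 0"
    "ip (adj V ?T) ?v = p" "ip (adj V ?S) ?v = 0" 
  proof -
    have "{w \<in> T. E v w} = T" using vT by auto
    then show "ip (adj V ?T) ?v = p"
      using V sub by (simp add: ip_indicator adj_indicator p_def)
  qed (use V sub T S vS irrefl in \<open>simp_all add: ip_indicator adj_indicator zero\<close>)
  have f: "f \<le> p * e"
  proof -
    have "f = (\<Sum>u\<in>T. real (card {w \<in> S. E u w}))"
      using V by (simp add: f_def ip_indicator adj_indicator)
    also have "\<dots> \<le> (\<Sum>u\<in>T. e)" using TS by (intro sum_mono) (simp add: e_def)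
    finally show ?thesis by (simp add: p_def)
  qed
  have form: "ip (adj V ?x) ?x = 2 * a * p - 2 * a * b * f"
    using adj_self_adjoint[of V ?v ?T] adj_self_adjoint[of V ?v ?S] adj_self_adjoint[of V ?T ?S] forms
    by (simp add: adj_linear ip_linear f_def ip_commute[of _ "adj V _"] algebra_simps)
  have norms: "ip ?v ?v = 1" "ip ?T ?T = p" "ip ?S ?S = q" "ip ?v ?T = 0" "ip ?v ?S = 0" "ip ?T ?S = 0"
    using V sub disj fin by (auto simp: ip_indicator p_def q_def ip_def indicator_def Int_absorb1 intro!: sum.neutral)
  have norm: "ip ?x ?x = 1 + a\<^sup>2 * p + b\<^sup>2 * q"
    by (simp add: ip_linear norms ip_commute[of ?T ?v] ip_commute[of ?S ?v] ip_commute[of ?S ?T]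
        power2_eq_square)
  have "(\<Sum>u\<in>V. ?x u) = 1 + a * p - b * q"
    using V sub by (simp add: sum.distrib sum_subtractf p_def q_def sum_indicator_real
        flip: sum_distrib_left)
  then have "(\<Sum>u\<in>V. ?x u) = 0" using ab by simp
  then have "2 * a * p - 2 * a * b * f \<le> lam * (1 + a\<^sup>2 * p + b\<^sup>2 * q)"
    using psd_orthogonal[of ?x] by (simp only: form norm)
  moreover have "2 * a * b * f \<le> 2 * a * b * (p * e)"
    using f a0 b0 by (intro mult_left_mono) auto
  ultimately have "2 * (a * p) - 2 * (a * p) * b * e \<le> lam * (1 + a * (a * p) + b * (b * q))"
    by (simp add: power2_eq_square algebra_simps)
  then have "lam * 2 \<le> lam * (1 + a * lam + b * (real k + 2 * e))"
    unfolding ab by (simp add: algebra_simps)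
  then have "2 \<le> 1 + a * lam + b * (real k + 2 * e)"
    by (rule mult_left_le_imp_le) (use lam_pos in linarith)
  then have "1 \<le> a * lam + b * (real k + 2 * e)" by simp
  moreover have "a * lam \<le> 1 / 3"
  proof -
    have "lam\<^sup>2 \<le> (real k)\<^sup>2" using kr by (intro power_mono) auto
    then have "3 * (lam * lam) \<le> p" using p by (simp add: power2_eq_square)
    then show ?thesis using p0 by (simp add: a_def field_simps)
  qed
  moreover have "b * (real k + 2 * e) \<le> 1 / 3"
    using q q0 by (simp add: b_def field_simps power2_eq_square)
  ultimately show False by simp
qed

text \<open>
  A vertex cannot have both many neighbours and many non-neighbours in the independent set \<open>S\<close>, so
  by \<open>half\<close> it has few neighbours there.  If it had very many neighbours altogether, then by
  Ramsey's theorem, and because large cliques do not exist, an independent set \<open>T\<close> of them would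
  be large, and \<open>T\<close> together with the rest of \<open>S\<close> would contradict \<open>star_test\<close>.
\<close>

lemma degree_bound:
  assumes S: "S \<subseteq> V" "card S = 30 * k ^ 3" "\<And>u w. u \<in> S \<Longrightarrow> w \<in> S \<Longrightarrow> \<not> E u w"
    and half: "\<And>v. v \<in> V \<Longrightarrow> card {s \<in> S. E v s} \<le> 15 * k ^ 3"
    and v: "v \<in> V"
  shows "card {w. E v w} \<le> 2 ^ (2 * k + 1 + 3 * k\<^sup>2)"
proof -
  have finS: "finite S" using S(1) fin finite_subset by blast
  have k32: "2 * k\<^sup>2 \<le> k ^ 3" using k by (simp add: power2_eq_square power3_eq_cube)
  have k24: "4 \<le> k\<^sup>2" using power_mono[of 2 k 2] k by simp
  have few: "card {s \<in> S. E u s} < 3 * k\<^sup>2" if u: "u \<in> V" for u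
  proof (rule ccontr)
    assume "\<not> ?thesis"
    then have large: "3 * k\<^sup>2 \<le> card {s \<in> S. E u s}" by simp
    then have "{s \<in> S. E u s} \<noteq> {}" using k24 by (intro notI) simp
    then have "u \<notin> S" using S(3) by auto
    have "card (S - {s \<in> S. E u s}) = card S - card {s \<in> S. E u s}"
      using finS by (intro card_Diff_subset) auto
    then have rest: "3 * k\<^sup>2 + 6 * k * 0 \<le> card (S - {s \<in> S. E u s})"
      using half[OF u] S(2) k32 k24 by linarith
    show False
      by (rule star_test[OF u _ _ _ _ _ _ _ _ _ _ large rest])
         (use S \<open>u \<notin> S\<close> in \<open>auto simp: card_eq_0_iff\<close>)
  qed
  show ?thesis
  proof (rule ccontr)
    assume "\<not> ?thesis"
    then have "2 ^ (2 * k + 1 + 3 * k\<^sup>2) \<le> card {w. E v w}" by simp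
    moreover have "finite {w. E v w}" using verts2 by (intro finite_subset[OF _ fin]) auto
    ultimately consider
        K where "K \<subseteq> {w. E v w}" "card K = 2 * k + 1" "\<forall>u\<in>K. \<forall>w\<in>K. u \<noteq> w \<longrightarrow> E u w"
      | K where "K \<subseteq> {w. E v w}" "card K = 3 * k\<^sup>2" "\<forall>u\<in>K. \<forall>w\<in>K. u \<noteq> w \<longrightarrow> \<not> E u w"
      using ramsey_power_of_two[of "{w. E v w}" "2 * k + 1" "3 * k\<^sup>2" E] sym by blast
    then show False
    proof cases
      case (1 K)
      then have "K \<subseteq> V" using verts2 by auto
      then show False using no_large_clique 1 by blast
    next
      case (2 T)
      then have TV: "T \<subseteq> V" using verts2 by auto
      define S' where "S' = S - {s \<in> S. E v s} - {v}"
      have "card S - card {s \<in> S. E v s} - 1 \<le> card S'"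
        unfolding S'_def using finS
        by (metis (no_types, lifting) card.empty card.insert card_Diff_subset diff_card_le_card_Diff
            finite.emptyI finite.insertI empty_iff mem_Collect_eq subsetI finite_subset One_nat_def)
      then have S': "3 * k\<^sup>2 + 6 * k * (3 * k\<^sup>2) \<le> card S'"
      proof -
        have "6 * k * (3 * k\<^sup>2) = 18 * k ^ 3" by (simp add: power2_eq_square power3_eq_cube)
        then show ?thesis
          using \<open>card S - card {s \<in> S. E v s} - 1 \<le> card S'\<close> few[OF v] S(2) k32 k24 by linarith
      qed
      have few': "card {w \<in> S'. E u w} \<le> 3 * k\<^sup>2" if "u \<in> T" for u
      proof -
        have "card {w \<in> S'. E u w} \<le> card {w \<in> S. E u w}"
          using finS by (intro card_mono) (auto simp: S'_def)
        then show ?thesis using few[of u] that TV by fastforce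
      qed
      have TE: "E v u" if "u \<in> T" for u using 2(1) that by auto
      have TT: "\<not> E u w" if "u \<in> T" "w \<in> T" for u w using 2(3) that irrefl by metis
      show False
        by (rule star_test[OF v TV _ _ _ _ TT _ TE _ few' _ S'])
           (use 2(2) S irrefl TE irrefl[of v] in \<open>auto simp: S'_def dest: TE\<close>)
    qed
  qed
qed

section \<open>Largest eigenvalue at most \<open>k - 1\<close>\<close>

text \<open>
  When the form is bounded by \<open>\<lambda>\<close>, a linear dependency \<open>x\<close> between the Gram vectors has sum zero
  and is a \<open>\<lambda>\<close>-eigenvector.  Then \<open>|x|\<close> maximises the form as well, so the positive part of
  \<open>x\<close> is an eigenvector to which Perron--Frobenius applies.
\<close>

lemma dependency_component:
  assumes form: "\<And>z. ip (adj V z) z \<le> lam * ip z z"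
    and dep: "\<And>i. i < d \<Longrightarrow> (\<Sum>w\<in>V. c w i * x w) = 0"
    and v: "v \<in> V" "x v > 0"
  shows "sum x V = 0" "k \<le> card (component v)" "\<And>u. u \<in> component v \<Longrightarrow> 0 < x u"
proof -
  have "ip (adj V x) x = lam * ip x x + (sum x V)\<^sup>2 / 2" by (rule dependency_form(2)[OF dep])
  moreover have "ip (adj V x) x \<le> lam * ip x x" by (rule form)
  ultimately have "(sum x V)\<^sup>2 \<le> 0" by linarith
  then show s: "sum x V = 0" by simp
  have eig: "adj V x u = lam * x u" if "u \<in> V" for u
    using dependency_form(1)[OF dep that] s by simp
  define z where "z = (\<lambda>u. \<bar>x u\<bar>)"
  have "ip (adj V x) x = lam * ip x x" using dependency_form(2)[OF dep] s by simp
  then have "lam * ip z z \<le> ip (adj V z) z"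
    using abs_form_le[of V x] ip_abs[of x] by (simp add: z_def)
  then have "ip (adj V z) z = lam * ip z z" using form[of z] by linarith
  then have eigz: "adj V z u = lam * z u" if "u \<in> V" for u
    using form_maximiser_eigenvector[OF form _ that] by blast
  \<comment> \<open>Twice the positive part of \<open>x\<close>.\<close>
  define p where "p = (\<lambda>u. z u + x u)"
  have p_eig: "adj V p u = lam * p u" if "u \<in> V" for u
    using eig[OF that] eigz[OF that] by (simp add: p_def adj_add algebra_simps)
  have p_nonneg: "0 \<le> p u" for u by (simp add: p_def z_def)
  have pv: "p v > 0" using v by (simp add: p_def z_def)
  show "k \<le> card (component v)"
    using nonneg_eigenvector_component_card[OF p_eig p_nonneg v(1) pv] by simp
  show "0 < x u" if "u \<in> component v" for u
    using nonneg_eigenvector_positive[OF p_eig p_nonneg v(1) pv that]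
    by (simp add: p_def z_def abs_if split: if_splits)
qed

text \<open>
  Pick one vertex in every component with at least \<open>k\<close> vertices, except in one component \<open>C0\<close>.
  The remaining vectors are linearly independent: a dependency vanishing at the chosen vertices
  vanishes outside \<open>C0\<close>, and inside \<open>C0\<close> it has constant sign, which contradicts that its
  coordinates sum to zero.
\<close>

lemma card_bound_if_form_bounded:
  assumes form: "\<And>z. ip (adj V z) z \<le> lam * ip z z" and d: "k \<le> d"
  shows "card V * (k - 1) \<le> k * (d - 1)"
proof -
  define big where "big = {C \<in> component ` V. k \<le> card C}"
  have big_sub: "C \<subseteq> V" if "C \<in> big" for C
    using that component_subset by (auto simp: big_def)
  have fin_big: "finite big" using fin by (simp add: big_def)
  have disj: "C = C'" if "C \<in> big" "C' \<in> big" "u \<in> C" "u \<in> C'" for C C' u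
  proof -
    obtain a b where "C = component a" "C' = component b" using \<open>C \<in> big\<close> \<open>C' \<in> big\<close>
      by (auto simp: big_def)
    then show ?thesis using component_eq[of u a] component_eq[of u b] that by simp
  qed
  have "card big * k \<le> (\<Sum>C\<in>big. card C)"
    using sum_mono[of big "\<lambda>_. k" card] by (simp add: big_def)
  also have "\<dots> = card (\<Union>C\<in>big. C)"
  proof (rule card_UN_disjoint[symmetric])
    show "\<forall>C\<in>big. finite C" using big_sub fin finite_subset by blast
    show "\<forall>C\<in>big. \<forall>C'\<in>big. C \<noteq> C' \<longrightarrow> C \<inter> C' = {}" using disj by blast
  qed (rule fin_big)
  also have "\<dots> \<le> card V" using big_sub fin by (intro card_mono) auto
  finally have big_card: "card big * k \<le> card V" .
  define rep where "rep C = (SOME u. u \<in> C)" for C :: "'a set"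
  have rep: "rep C \<in> C" if "C \<in> big" for C
  proof -
    have "\<exists>u. u \<in> C" using that component_self by (auto simp: big_def)
    then show ?thesis unfolding rep_def by (rule someI_ex)
  qed
  have sign: "component v \<in> big \<and> sum x V = 0 \<and>
      ((\<forall>u\<in>component v. 0 < x u) \<or> (\<forall>u\<in>component v. x u < 0))"
    if dep: "\<And>i. i < d \<Longrightarrow> (\<Sum>w\<in>V. c w i * x w) = 0" and v: "v \<in> V" "x v \<noteq> 0" for x v
  proof (cases "x v > 0")
    case True
    show ?thesis
      using dependency_component[OF form dep v(1) True] v(1) unfolding big_def by blast
  next
    case False
    have dep': "(\<Sum>w\<in>V. c w i * - x w) = 0" if "i < d" for i
      using dep[OF that] by (simp add: sum_negf)
    have "- x v > 0" using False v(2) by simp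
    note neg = dependency_component[OF form dep' v(1) this]
    have "\<forall>u\<in>component v. x u < 0" using neg(3) by fastforce
    moreover have "sum x V = 0" using neg(1) by (simp add: sum_negf)
    ultimately show ?thesis using neg(2) v(1) unfolding big_def by blast
  qed
  have independent: "card V - card R \<le> d"
    if R: "R \<subseteq> V" and no: "\<And>x. (\<And>i. i < d \<Longrightarrow> (\<Sum>w\<in>V. c w i * x w) = 0) \<Longrightarrow>
      (\<And>u. u \<in> R \<Longrightarrow> x u = 0) \<Longrightarrow> \<exists>v\<in>V. x v \<noteq> 0 \<Longrightarrow> False" for R
  proof (rule ccontr)
    assume "\<not> ?thesis"
    then have "card {..<d} < card (V - R)"
      using R fin by (simp add: card_Diff_subset finite_subset)
    from homogeneous_system_nontrivial[OF _ _ this, of "\<lambda>i v. c v i"] fin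
    obtain x where x: "\<exists>v\<in>V - R. x v \<noteq> 0" "\<forall>v. v \<notin> V - R \<longrightarrow> x v = 0"
      "\<forall>i\<in>{..<d}. (\<Sum>v\<in>V - R. c v i * x v) = 0" by auto
    have "(\<Sum>v\<in>V. c v i * x v) = (\<Sum>v\<in>V - R. c v i * x v)" for i
      using fin x(2) by (intro sum.mono_neutral_right) auto
    then show False using no[of x] x by auto
  qed
  show ?thesis
  proof (cases "big = {}")
    case True
    then have "card V \<le> d" using independent[of "{}"] sign by fastforce
    then have "card V * (k - 1) \<le> d * (k - 1)" by simp
    also have "\<dots> \<le> k * (d - 1)" using d k by (simp add: algebra_simps diff_mult_distrib2)
    finally show ?thesis .
  next
    case False
    then obtain C0 where C0: "C0 \<in> big" by blast
    define R where "R = rep ` (big - {C0})"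
    have cardR: "card R + 1 \<le> card big"
    proof -
      have "card R \<le> card (big - {C0})" using fin_big by (simp add: R_def card_image_le)
      moreover have "0 < card big" using C0 fin_big card_gt_0_iff by blast
      ultimately show ?thesis using C0 fin_big by simp
    qed
    have "card V - card R \<le> d"
    proof (rule independent)
      show "R \<subseteq> V" using rep big_sub by (auto simp: R_def)
      fix x assume dep: "\<And>i. i < d \<Longrightarrow> (\<Sum>w\<in>V. c w i * x w) = 0"
        and xR: "\<And>u. u \<in> R \<Longrightarrow> x u = 0" and ex: "\<exists>v\<in>V. x v \<noteq> 0"
      have only: "component v = C0" if "v \<in> V" "x v \<noteq> 0" for v
      proof (rule ccontr)
        assume "component v \<noteq> C0"
        then have "rep (component v) \<in> R" using sign[OF dep that] by (auto simp: R_def)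
        then show False using xR sign[OF dep that] rep by fastforce
      qed
      obtain v where v: "v \<in> V" "x v \<noteq> 0" using ex by blast
      have C0V: "C0 \<subseteq> V" using big_sub C0 by blast
      have outside: "x u = 0" if "u \<in> V - C0" for u
        using only[of u] that component_self[of u] by blast
      have vC0: "v \<in> C0" using only[OF v] component_self[of v] by simp
      have finC0: "finite C0" using C0V fin finite_subset by blast
      have "sum x C0 = sum x V" using C0V fin outside by (intro sum.mono_neutral_left) auto
      also have "\<dots> = 0" using sign[OF dep v] by blast
      finally have s0: "sum x C0 = 0" .
      have "(\<forall>u\<in>C0. 0 < x u) \<or> (\<forall>u\<in>C0. x u < 0)" using sign[OF dep v] only[OF v] by simp
      then show False
      proof
        assume "\<forall>u\<in>C0. 0 < x u"
        then have "0 < sum x C0" using finC0 vC0 by (intro sum_pos) auto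
        then show False using s0 by simp
      next
        assume "\<forall>u\<in>C0. x u < 0"
        then have "0 < sum (\<lambda>u. - x u) C0" using finC0 vC0 by (intro sum_pos) auto
        then show False using s0 by (simp add: sum_negf)
      qed
    qed
    then have "card V + 1 \<le> d + card big" using cardR by linarith
    then have "k * (card V + 1) \<le> k * d + card V"
      using mult_le_mono2[of "card V + 1" "d + card big" k] big_card by (simp add: algebra_simps)
    moreover obtain k' where "k = Suc k'" using k by (cases k) auto
    moreover obtain d' where "d = Suc d'" using d k by (cases d) auto
    ultimately show ?thesis by (simp add: algebra_simps)
  qed
qed

section \<open>Largest eigenvalue above \<open>k - 1\<close>\<close>

text \<open>
  Two vectors with disjoint and non-adjacent supports at which the form is at or above \<open>\<lambda>\<close>,
  strictly for one of them, can be combined to one with coordinate sum zero, contradicting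
  \<open>psd_orthogonal\<close>.  This is how semidefiniteness controls the second eigenvalue.
\<close>

lemma two_lumps:
  assumes x: "\<And>u. u \<notin> X \<Longrightarrow> x u = 0" and y: "\<And>u. u \<notin> Y \<Longrightarrow> y u = 0"
    and disj: "X \<inter> Y = {}" and noedge: "\<And>u w. u \<in> X \<Longrightarrow> w \<in> Y \<Longrightarrow> \<not> E u w"
    and fx: "lam * ip x x < ip (adj V x) x" and fy: "lam * ip y y \<le> ip (adj V y) y"
    and y0: "v \<in> V" "y v \<noteq> 0"
  shows False
proof -
  define x' where "x' = (\<lambda>u. \<bar>x u\<bar>)"
  define y' where "y' = (\<lambda>u. \<bar>y u\<bar>)"
  have fx': "lam * ip x' x' < ip (adj V x') x'"
    using abs_form_le[of V x] fx ip_abs[of x] by (simp add: x'_def)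
  have fy': "lam * ip y' y' \<le> ip (adj V y') y'"
    using abs_form_le[of V y] fy ip_abs[of y] by (simp add: y'_def)
  define p where "p = sum x' V"
  define q where "q = sum y' V"
  have q: "q > 0" unfolding q_def using fin y0 by (intro sum_pos2[of V v]) (auto simp: y'_def)
  have cross: "ip x' y' = 0" unfolding ip_def
  proof (intro sum.neutral ballI)
    fix u
    have "u \<notin> X \<or> u \<notin> Y" using disj by auto
    then show "x' u * y' u = 0" using x y by (auto simp: x'_def y'_def)
  qed
  have cross2: "ip (adj V x') y' = 0" unfolding ip_def
  proof (intro sum.neutral ballI)
    fix w
    show "adj V x' w * y' w = 0"
    proof (cases "w \<in> Y")
      case True
      then have "adj V x' w = 0"
        unfolding adj_def using noedge sym x by (intro sum.neutral) (fastforce simp: x'_def)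
      then show ?thesis by simp
    qed (use y in \<open>simp add: y'_def\<close>)
  qed
  let ?z = "\<lambda>u. q * x' u - p * y' u"
  have "sum ?z V = 0" by (simp add: sum_subtractf p_def q_def flip: sum_distrib_left)
  then have "ip (adj V ?z) ?z \<le> lam * ip ?z ?z" by (rule psd_orthogonal)
  then have "q\<^sup>2 * ip (adj V x') x' + p\<^sup>2 * ip (adj V y') y' \<le> lam * (q\<^sup>2 * ip x' x' + p\<^sup>2 * ip y' y')"
    using cross cross2 adj_self_adjoint[of V y' x']
    by (simp add: adj_linear ip_linear ip_commute[of y' x'] ip_commute[of y' "adj V x'"]
        power2_eq_square mult.assoc)
  moreover have "q\<^sup>2 * (lam * ip x' x') < q\<^sup>2 * ip (adj V x') x'" using fx' q by simp
  moreover have "p\<^sup>2 * (lam * ip y' y') \<le> p\<^sup>2 * ip (adj V y') y'" using fy' by (intro mult_left_mono) auto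
  ultimately show False by (simp add: algebra_simps)
qed

text \<open>
  Here \<open>r\<close> is the radius of the net and \<open>r j\<close> the number of steps of the walks; the left-hand
  side is a lower bound for the dimension \<open>m\<close> of the space of \<open>\<lambda>\<close>-eigenvectors that vanish on the
  deleted set \<open>R\<close>.  Every vertex of \<open>H\<close>, the rest of the component \<open>C\<close>, is near the net and is
  the centre of a ball on which the form is bounded, so walks inside \<open>H\<close> decay by
  \<open>local_walk_bound\<close>, and an eigenvector concentrated at one vertex turns this decay into a bound on
  \<open>m\<close>.  The \<open>2\<close> on the left stands for the centre added to the net and for the equation that
  makes the coordinate sum zero.
\<close>

lemma card_bound_if_form_exceeds:
  assumes deg: "\<And>u. u \<in> V \<Longrightarrow> card {w. E u w} \<le> D"
    and exceeds: "lam * ip y y < ip (adj V y) y" 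
  shows "real (card V) - real (card V) / real (r + 1) - 2 - real (D + 1) ^ (2 * (r * j) + 1) - real d
    \<le> real (card V) * (1 - 1 / lam ^ (2 * r)) ^ j"
proof -
  define N where "N = card V"
  define s where "s = r * j"
  obtain v0 y0 where v0: "v0 \<in> V" and y0: "\<And>u. u \<notin> component v0 \<Longrightarrow> y0 u = 0"
      "lam * ip y0 y0 < ip (adj V y0) y0"
    using component_exceeding_form[OF exceeds] by blast
  define C where "C = component v0"
  have CV: "C \<subseteq> V" using component_subset[OF v0] by (simp add: C_def)
  have finC: "finite C" using CV fin finite_subset by blast
  obtain R0 where R0: "R0 \<subseteq> C" "(r + 1) * card R0 \<le> card C + (r + 1)"
      "\<And>u. u \<in> C \<Longrightarrow> \<exists>w\<in>R0. w \<in> ball u r"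
    using sparse_net[OF v0, of r] unfolding C_def by blast
  \<comment> \<open>Centres of balls on which the form exceeds \<open>lam\<close>.  Any two of these balls touch or
    overlap, so all centres lie in one ball.\<close>
  define U where "U = {u \<in> V. \<exists>z. (\<forall>w. w \<notin> ball u s \<longrightarrow> z w = 0) \<and> lam * ip z z < ip (adj V z) z}"
  have cardU: "card U \<le> (D + 1) ^ (2 * s + 1)"
  proof (cases "U = {}")
    case False
    then obtain u0 where u0: "u0 \<in> U" by blast
    then obtain z0 where z0: "u0 \<in> V" "\<And>w. w \<notin> ball u0 s \<Longrightarrow> z0 w = 0" "lam * ip z0 z0 < ip (adj V z0) z0"
      by (auto simp: U_def)
    have "u \<in> ball u0 (2 * s + 1)" if "u \<in> U" for u
    proof (rule ccontr)
      assume far: "u \<notin> ball u0 (2 * s + 1)"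
      from that obtain z where z: "u \<in> V" "\<And>w. w \<notin> ball u s \<Longrightarrow> z w = 0" "lam * ip z z < ip (adj V z) z"
        by (auto simp: U_def)
      have noedge: "\<not> E a b" if "a \<in> ball u0 s" "b \<in> ball u s" for a b
      proof
        assume "E a b"
        then have "b \<in> ball u0 (s + 1)" using that(1) by auto
        from ball_trans[OF this ball_sym[OF that(2)]] show False using far by (simp add: mult_2)
      qed
      have disj: "ball u0 s \<inter> ball u s = {}"
      proof (rule ccontr)
        assume "ball u0 s \<inter> ball u s \<noteq> {}"
        then obtain a where "a \<in> ball u0 s" "a \<in> ball u s" by blast
        from ball_trans[OF this(1) ball_sym[OF this(2)]] have "u \<in> ball u0 (2 * s)" by (simp add: mult_2)
        then show False using far ball_mono[of "2 * s" "2 * s + 1" u0] by auto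
      qed
      have "\<exists>v\<in>V. z v \<noteq> 0"
      proof (rule ccontr)
        assume "\<not> ?thesis"
        then have "ip z z = 0" "ip (adj V z) z = 0" by (auto simp: ip_def)
        then show False using z(3) by simp
      qed
      then obtain v where "v \<in> V" "z v \<noteq> 0" by blast
      then show False
        using two_lumps[OF z0(2) z(2) disj noedge z0(3) less_imp_le[OF z(3)]] by blast
    qed
    then have "card U \<le> card (ball u0 (2 * s + 1))"
      by (intro card_mono finite_subset[OF ball_subset[OF z0(1)] fin] subsetI)
    also have "\<dots> \<le> (D + 1) ^ (2 * s + 1)" by (rule card_ball_le[OF deg z0(1)])
    finally show ?thesis .
  qed simp
  define R where "R = R0 \<union> U"
  have RV: "R \<subseteq> V" using R0 CV by (auto simp: R_def U_def)
  have cardR: "real (card R) \<le> real N / real (r + 1) + 1 + real (D + 1) ^ (2 * s + 1)"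
  proof -
    have "card C \<le> N" using CV fin by (simp add: N_def card_mono)
    then have "(r + 1) * card R0 \<le> N + (r + 1)" using R0(2) by simp
    then have "real ((r + 1) * card R0) \<le> real (N + (r + 1))" by (rule of_nat_mono)
    then have "real (card R0) \<le> real N / real (r + 1) + 1" by (simp add: field_simps)
    moreover have "real (card U) \<le> real (D + 1) ^ (2 * s + 1)"
      using of_nat_mono[OF cardU, where 'a = real] by (simp only: of_nat_power)
    moreover have "card R \<le> card R0 + card U" unfolding R_def by (rule card_Un_le)
    ultimately show ?thesis by linarith
  qed
  have rhs_nonneg: "0 \<le> real N * (1 - 1 / lam ^ (2 * r)) ^ j"
    using lam_pos by (intro mult_nonneg_nonneg zero_le_power) auto
  define m where "m = card (V - R) - (d + 1)"
  have cardVR: "card (V - R) = N - card R" "card R \<le> N"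
    using RV fin by (auto simp: N_def card_Diff_subset finite_subset card_mono)
  have "real m \<le> real N * (1 - 1 / lam ^ (2 * r)) ^ j"
  proof (cases "m = 0")
    case True
    then show ?thesis using rhs_nonneg by simp
  next
    case False
    \<comment> \<open>The equations for linear dependencies, together with coordinate sum zero.\<close>
    define a where "a i v = (if i = d then 1 else c v i)" for i v
    have "card {..d} + m \<le> card (V - R)" using False by (simp add: m_def)
    from concentrated_solution[OF _ _ this, of a] fin False obtain x p where
      p: "p \<in> V - R" "x p \<noteq> 0" and x_out: "\<And>v. v \<notin> V - R \<Longrightarrow> x v = 0"
      and sol: "\<And>i. i \<le> d \<Longrightarrow> (\<Sum>v\<in>V - R. a i v * x v) = 0"
      and conc: "real m * (\<Sum>v\<in>V - R. (x v)\<^sup>2) \<le> real (card (V - R)) * (x p)\<^sup>2"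
      by (auto simp: Ball_def)
    have extend: "(\<Sum>v\<in>V. f v) = (\<Sum>v\<in>V - R. f v)" if "\<And>v. x v = 0 \<Longrightarrow> f v = 0" for f :: "'a \<Rightarrow> real"
      using fin x_out that by (intro sum.mono_neutral_right) auto
    have dep: "(\<Sum>v\<in>V. c v i * x v) = 0" if "i < d" for i
      using sol[of i] that by (subst extend) (auto simp: a_def)
    have "sum x V = 0" using sol[of d] by (subst extend) (auto simp: a_def)
    then have eig: "adj V x u = lam * x u" if "u \<in> V" for u
      using dependency_form(1)[OF dep that] by simp
    \<comment> \<open>A part outside \<open>C\<close> would be a \<open>lam\<close>-eigenvector, which \<open>C\<close> does not tolerate.\<close>
    have off_C: "x v = 0" if "v \<in> V" "v \<notin> C" for v
    proof (rule ccontr)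
      assume xv: "x v \<noteq> 0"
      define z where "z = (\<lambda>u. if u \<in> C then 0 else x u)"
      have "adj V z u * z u = lam * (z u * z u)" if "u \<in> V" for u
      proof (cases "u \<in> C")
        case False
        have "adj V z u = adj V x u" unfolding adj_def z_def
          using False component_closed[of u _ v0] by (intro sum.cong) (auto simp: C_def)
        then show ?thesis using eig[OF that] False by (simp add: z_def)
      qed (simp add: z_def)
      then have "ip (adj V z) z = lam * ip z z"
        unfolding ip_def sum_distrib_left by (intro sum.cong refl)
      then have "lam * ip z z \<le> ip (adj V z) z" by simp
      moreover have "\<not> E a b" if "a \<in> C" "b \<in> - C" for a b
        using that component_closed[of a b v0] by (auto simp: C_def)
      moreover have "y0 u = 0" if "u \<notin> C" for u using y0(1) that by (simp add: C_def)
      moreover have "z u = 0" if "u \<notin> - C" for u using that by (simp add: z_def)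
      moreover have "z v \<noteq> 0" using xv that by (simp add: z_def)
      ultimately show False
        using two_lumps[of C y0 "- C" z v] y0(2) that(1) by blast
    qed
    define H where "H = C - R"
    have HV: "H \<subseteq> V" using CV by (auto simp: H_def)
    have x_H: "x u = 0" if "u \<notin> H" for u
      using that x_out off_C by (auto simp: H_def)
    have pH: "p \<in> H" using p x_H by blast
    have exit: "\<not> ball u r \<subseteq> H" if "u \<in> H" for u
      using R0(3)[of u] that by (auto simp: H_def R_def)
    have form: "ip (adj V z) z \<le> lam * ip z z" if "\<And>u. u \<notin> ball p (r * j) \<Longrightarrow> z u = 0" for z
    proof (rule ccontr)
      assume "\<not> ?thesis"
      then have "lam * ip z z < ip (adj V z) z" by simp
      then have "p \<in> U" using that p(1) unfolding U_def s_def by blast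
      then show False using p(1) by (simp add: R_def)
    qed
    define B where "B = lam ^ (2 * r) - 1"
    have "lam ^ (2 * s) * (x p)\<^sup>2 \<le> ip ((adj H ^^ s) (delta p)) ((adj H ^^ s) (delta p)) * ip x x"
      by (rule eigenvector_entry_bound[OF HV pH x_H eig])
    also have "\<dots> \<le> B ^ j * ip x x"
      unfolding s_def B_def
      by (intro mult_right_mono local_walk_bound[OF HV exit pH form lam_pos] ip_nonneg)
    finally have entry: "lam ^ (2 * s) * (x p)\<^sup>2 \<le> B ^ j * ip x x" .
    have ipx: "ip x x = (\<Sum>v\<in>V - R. (x v)\<^sup>2)"
      unfolding ip_def by (subst extend) (auto simp: power2_eq_square)
    have lampos: "0 < lam ^ n" for n using lam_pos by simp
    have "lam ^ (2 * s) * (real m * ip x x) \<le> lam ^ (2 * s) * (real N * (x p)\<^sup>2)"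
    proof (intro mult_left_mono)
      have "real m * ip x x \<le> real (card (V - R)) * (x p)\<^sup>2" using conc by (simp add: ipx)
      also have "\<dots> \<le> real N * (x p)\<^sup>2" using cardVR by (intro mult_right_mono) auto
      finally show "real m * ip x x \<le> real N * (x p)\<^sup>2" .
    qed (use lampos less_imp_le in blast)
    also have "\<dots> = real N * (lam ^ (2 * s) * (x p)\<^sup>2)" by simp
    also have "\<dots> \<le> real N * (B ^ j * ip x x)" using entry by (intro mult_left_mono) auto
    finally have "(lam ^ (2 * s) * real m) * ip x x \<le> (real N * B ^ j) * ip x x" by (simp add: mult.assoc)
    moreover have "ip x x > 0" using p ip_pos by blast
    ultimately have "lam ^ (2 * s) * real m \<le> real N * B ^ j" by simp
    then have "real m \<le> real N * (B ^ j / lam ^ (2 * s))" using lampos by (simp add: field_simps)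
    also have "B ^ j / lam ^ (2 * s) = (1 - 1 / lam ^ (2 * r)) ^ j"
    proof -
      have "lam ^ (2 * s) = (lam ^ (2 * r)) ^ j" by (simp add: s_def power_mult mult.assoc)
      then have "B ^ j / lam ^ (2 * s) = (B / lam ^ (2 * r)) ^ j" by (simp add: power_divide)
      also have "B / lam ^ (2 * r) = 1 - 1 / lam ^ (2 * r)" 
      proof -
        have "lam ^ (2 * r) \<noteq> 0" using lampos[of "2 * r"] by linarith
        from divide_self[OF this] show ?thesis by (simp only: B_def diff_divide_distrib)
      qed
      finally show ?thesis .
    qed
    finally show ?thesis .
  qed
  moreover have "real N - real (card R) - real d - 1 \<le> real m"
    using cardVR by (simp add: m_def)
  ultimately show ?thesis using cardR unfolding N_def s_def by linarith
qed

end

section \<open>Switching and the upper bound\<close>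

text \<open>
  The graph of the vectors \<open>\<sigma> v\<close> times \<open>x v\<close>: the same lines, other choices of signs.
\<close>

definition switched_edge :: "'a set \<Rightarrow> nat \<Rightarrow> ('a \<Rightarrow> nat \<Rightarrow> real) \<Rightarrow> ('a \<Rightarrow> real) \<Rightarrow> 'a \<Rightarrow> 'a \<Rightarrow> bool" where
  "switched_edge V d x \<sigma> u w \<longleftrightarrow>
     u \<in> V \<and> w \<in> V \<and> u \<noteq> w \<and> \<sigma> u * \<sigma> w * (\<Sum>i<d. x u i * x w i) < 0"

lemma switched_gram_graph:
  assumes V: "finite V" and k: "k \<ge> 2"
    and unit: "\<And>v. v \<in> V \<Longrightarrow> (\<Sum>i<d. x v i * x v i) = 1"
    and angle: "\<And>u w. u \<in> V \<Longrightarrow> w \<in> V \<Longrightarrow> u \<noteq> w \<Longrightarrow> \<bar>\<Sum>i<d. x u i * x w i\<bar> = 1 / (2 * real k - 1)"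
    and \<sigma>: "\<And>v. \<sigma> v = 1 \<or> \<sigma> v = - 1"
  shows "gram_graph V (switched_edge V d x \<sigma>) k d (\<lambda>v i. \<sigma> v * sqrt ((2 * real k - 1) / 2) * x v i)"
proof unfold_locales
  define b where "b = 2 * real k - 1"
  have b: "b > 0" using k by (simp add: b_def)
  show "finite V" by (rule V)
  show "2 \<le> k" by (rule k)
  fix u w
  show "switched_edge V d x \<sigma> u w \<Longrightarrow> switched_edge V d x \<sigma> w u"
    by (auto simp: switched_edge_def mult.commute)
  show "\<not> switched_edge V d x \<sigma> u u" by (simp add: switched_edge_def)
  show "switched_edge V d x \<sigma> u w \<Longrightarrow> u \<in> V" by (simp add: switched_edge_def)
  assume uw: "u \<in> V" "w \<in> V"
  define g where "g = (\<Sum>i<d. x u i * x w i)"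
  have sq: "sqrt (b / 2) * sqrt (b / 2) = b / 2" using b by simp
  have "(\<Sum>i<d. \<sigma> u * sqrt (b / 2) * x u i * (\<sigma> w * sqrt (b / 2) * x w i))
      = (\<Sum>i<d. (sqrt (b / 2) * sqrt (b / 2)) * (\<sigma> u * \<sigma> w) * (x u i * x w i))"
    by (intro sum.cong) (simp_all only: mult_ac)
  also have "\<dots> = b / 2 * (\<sigma> u * \<sigma> w * g)"
    by (simp only: sq g_def sum_distrib_left mult.assoc)
  also have "\<dots> = (if u = w then real k - 1 else 0) - (if switched_edge V d x \<sigma> u w then 1 else 0) + 1 / 2"
  proof (cases "u = w")
    case True
    have "\<sigma> w * \<sigma> w = 1" using \<sigma>[of w] by auto
    then show ?thesis using True unit[OF uw(2)]
      by (simp add: g_def switched_edge_def b_def field_simps)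
  next
    case False
    define y where "y = \<sigma> u * \<sigma> w * g"
    have "\<bar>g\<bar> = 1 / b" using angle[OF uw False] by (simp add: g_def b_def)
    then have "\<bar>y\<bar> = 1 / b" using \<sigma>[of u] \<sigma>[of w] by (auto simp: y_def abs_mult)
    moreover have "switched_edge V d x \<sigma> u w \<longleftrightarrow> y < 0"
      using uw False by (simp add: switched_edge_def y_def g_def)
    ultimately show ?thesis
      unfolding y_def[symmetric] using False b by (cases "y < 0") (auto simp: abs_if field_simps)
  qed
  finally show "(\<Sum>i<d. \<sigma> u * sqrt ((2 * real k - 1) / 2) * x u i * (\<sigma> w * sqrt ((2 * real k - 1) / 2) * x w i))
      = (if u = w then real k - 1 else 0) - (if switched_edge V d x \<sigma> u w then 1 else 0) + 1 / 2"
    by (simp only: b_def)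
qed

lemma decay_estimate:
  assumes k: "(k::nat) \<ge> 2"
  shows "(1 - 1 / (real k - 1) ^ (4 * k)) ^ (4 * k * k ^ (4 * k)) < 1 / (4 * real k)"
proof -
  define c where "c = (real k - 1) ^ (4 * k)"
  have c: "1 \<le> c" "c \<le> real k ^ (4 * k)"
    using k by (auto simp: c_def intro: power_mono)
  have "(1 - 1 / c) ^ (4 * k * k ^ (4 * k)) \<le> exp (- (1 / c)) ^ (4 * k * k ^ (4 * k))"
    using c(1) exp_ge_add_one_self[of "- (1 / c)"] by (intro power_mono) auto
  also have "\<dots> = exp (- (4 * real k * (real k ^ (4 * k) / c)))"
    by (simp add: exp_of_nat_mult[symmetric] field_simps)
  also have "\<dots> \<le> exp (- (4 * real k))"
  proof -
    have "1 \<le> real k ^ (4 * k) / c" using c by simp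
    then have "4 * real k * 1 \<le> 4 * real k * (real k ^ (4 * k) / c)" by (intro mult_left_mono) auto
    then show ?thesis by simp
  qed
  also have "\<dots> < 1 / (4 * real k)"
  proof -
    have "4 * real k < exp (4 * real k)" using exp_ge_add_one_self[of "4 * real k"] by linarith
    then show ?thesis using k by (simp add: exp_minus field_simps)
  qed
  finally show ?thesis by (simp add: c_def)
qed

lemma ramsey_threshold:
  assumes k: "(k::nat) \<ge> 2"
  shows "2 * k + 1 + 30 * k ^ 3 \<le> k ^ (4 * k + 12)"
proof -
  have "8 \<le> k ^ 3" using power_mono[of 2 k 3] k by simp
  have "k * (2 * 2) \<le> k * (k * k)" using k by (intro mult_le_mono2 mult_le_mono)
  then have "2 * k + 1 \<le> 2 * k ^ 3" using k by (simp only: power3_eq_cube mult.assoc)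
  then have "2 * k + 1 + 30 * k ^ 3 \<le> 2 ^ 5 * k ^ 3" by simp
  also have "\<dots> \<le> k ^ 5 * k ^ 3" using k by (intro mult_le_mono1 power_mono) auto
  also have "\<dots> = k ^ 8" by (simp flip: power_add)
  also have "\<dots> \<le> k ^ (4 * k + 12)" using k by (intro power_increasing) auto
  finally show ?thesis .
qed

text \<open>
  The error terms of \<open>card_bound_if_form_exceeds\<close> for the degree bound \<open>2^(2k+1+3k^2)\<close>,
  \<open>r = 2k\<close> and \<open>j = 4k * k^(4k)\<close>, where \<open>j\<close> is dictated by \<open>decay_estimate\<close>.
\<close>

lemma ball_threshold:
  assumes k: "(k::nat) \<ge> 2"
  shows "4 * k * (3 + (2 ^ (2 * k + 1 + 3 * k\<^sup>2) + 1) ^ (2 * (2 * k * (4 * k * k ^ (4 * k))) + 1))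
    \<le> 2 ^ (k ^ (4 * k + 12))"
proof -
  define e where "e = k ^ (4 * k + 11)"
  define W :: nat where "W = (2 ^ (2 * k + 1 + 3 * k\<^sup>2) + 1) ^ (2 * (2 * k * (4 * k * k ^ (4 * k))) + 1)"
  have kk: "2 * k \<le> k\<^sup>2" using k by (simp add: power2_eq_square)
  then have small: "2 * k + 2 \<le> 2 * k\<^sup>2" using k by linarith
  have "(2::nat) ^ (2 * k + 1 + 3 * k\<^sup>2) + 1 \<le> 2 ^ (2 * k + 2 + 3 * k\<^sup>2)"
    by (simp add: add.commute[of _ "1::nat"]) 
  also have "\<dots> \<le> 2 ^ (5 * k\<^sup>2)" using small by (intro power_increasing) auto
  finally have base: "(2::nat) ^ (2 * k + 1 + 3 * k\<^sup>2) + 1 \<le> 2 ^ (5 * k\<^sup>2)" .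
  have expo: "5 * k\<^sup>2 * (2 * (2 * k * (4 * k * k ^ (4 * k))) + 1) \<le> e"
  proof -
    have "1 \<le> k\<^sup>2 * k ^ (4 * k)" using k by (simp add: Suc_le_eq)
    then have "2 * (2 * k * (4 * k * k ^ (4 * k))) + 1 \<le> 17 * (k\<^sup>2 * k ^ (4 * k))"
      by (simp add: power2_eq_square mult.assoc)
    then have "5 * k\<^sup>2 * (2 * (2 * k * (4 * k * k ^ (4 * k))) + 1) \<le> 5 * k\<^sup>2 * (17 * (k\<^sup>2 * k ^ (4 * k)))"
      by (rule mult_le_mono2)
    also have "\<dots> = 85 * (k ^ 4 * k ^ (4 * k))" by (simp add: power2_eq_square power4_eq_xxxx)
    also have "\<dots> \<le> 2 ^ 7 * (k ^ 4 * k ^ (4 * k))" by (intro mult_le_mono1) simp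
    also have "\<dots> \<le> k ^ 7 * (k ^ 4 * k ^ (4 * k))" using k by (intro mult_le_mono1 power_mono) auto
    also have "\<dots> = e" by (simp add: e_def mult.assoc add_ac flip: power_add)
    finally show ?thesis .
  qed
  have "W \<le> (2 ^ (5 * k\<^sup>2)) ^ (2 * (2 * k * (4 * k * k ^ (4 * k))) + 1)"
    unfolding W_def using base by (rule power_mono) simp
  also have "\<dots> \<le> 2 ^ e" unfolding power_mult[symmetric] using expo by (intro power_increasing) auto
  finally have W: "W \<le> 2 ^ e" .
  have k2: "k \<le> 2 ^ k" by (rule less_imp_le[OF less_exp])
  have "4 * k * (3 + W) \<le> 4 * 2 ^ k * (4 * 2 ^ e)"
  proof (intro mult_le_mono k2 order_refl)
    have "(1::nat) \<le> 2 ^ e" by simp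
    then show "3 + W \<le> 4 * 2 ^ e" using W by linarith
  qed
  also have "\<dots> = 2 ^ (4 + k + e)" by (simp add: power_add)
  also have "\<dots> \<le> 2 ^ (k ^ (4 * k + 12))"
  proof -
    have "(4::nat) \<le> 2 ^ k" using power_increasing[OF k, of "2::nat"] by simp
    moreover have "(2::nat) ^ (k + 2) = 4 * 2 ^ k" by (simp add: power_add)
    ultimately have "4 + k \<le> 2 ^ (k + 2)" using k2 by linarith
    also have "\<dots> \<le> k ^ (k + 2)" using k by (intro power_mono) auto
    also have "\<dots> \<le> e" unfolding e_def using k by (intro power_increasing) auto
    finally have "4 + k + e \<le> 2 * e" by simp
    also have "\<dots> \<le> k * e" using k by (intro mult_le_mono1)
    also have "\<dots> = k ^ (4 * k + 12)" by (simp add: e_def add.commute flip: power_Suc)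
    finally show ?thesis by (intro power_increasing) auto
  qed
  finally show ?thesis by (simp only: W_def)
qed

text \<open>
  The radius \<open>2k\<close> makes the net smaller than half of the \<open>N / k\<close> vertices that the
  multiplicity would have to account for; the remaining error terms together take less than the
  other half.
\<close>

lemma equiangular_vectors_bound:
  fixes V :: "'a set" and x :: "'a \<Rightarrow> nat \<Rightarrow> real"
  assumes V: "finite V" and k: "k \<ge> 2" and d: "k \<le> d"
    and unit: "\<And>v. v \<in> V \<Longrightarrow> (\<Sum>i<d. x v i * x v i) = 1"
    and angle: "\<And>u w. u \<in> V \<Longrightarrow> w \<in> V \<Longrightarrow> u \<noteq> w \<Longrightarrow> \<bar>\<Sum>i<d. x u i * x w i\<bar> = 1 / (2 * real k - 1)"
    and large: "2 ^ (k ^ (4 * k + 12)) \<le> card V"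
  shows "card V * (k - 1) \<le> k * (d - 1)"
proof -
  define E1 where "E1 = switched_edge V d x (\<lambda>_. 1)"
  interpret A: gram_graph V E1 k d "\<lambda>v i. 1 * sqrt ((2 * real k - 1) / 2) * x v i"
    unfolding E1_def by (rule switched_gram_graph[OF V k unit angle]) auto
  have "2 ^ (2 * k + 1 + 30 * k ^ 3) \<le> card V"
    using power_increasing[OF ramsey_threshold[OF k], of "2::nat"] large by simp
  have "\<exists>S\<subseteq>V. card S = 30 * k ^ 3 \<and> (\<forall>u\<in>S. \<forall>w\<in>S. u \<noteq> w \<longrightarrow> \<not> E1 u w)"
    using ramsey_power_of_two[OF V \<open>2 ^ (2 * k + 1 + 30 * k ^ 3) \<le> card V\<close> A.sym]
  proof
    assume "\<exists>K\<subseteq>V. card K = 2 * k + 1 \<and> (\<forall>u\<in>K. \<forall>w\<in>K. u \<noteq> w \<longrightarrow> E1 u w)"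
    then obtain K where "K \<subseteq> V" "card K = 2 * k + 1" "\<forall>u\<in>K. \<forall>w\<in>K. u \<noteq> w \<longrightarrow> E1 u w"
      by (elim exE conjE)
    then have False by (intro A.no_large_clique[of K]) auto
    then show ?thesis ..
  qed
  then obtain S where S1: "S \<subseteq> V" "card S = 30 * k ^ 3" "\<forall>u\<in>S. \<forall>w\<in>S. u \<noteq> w \<longrightarrow> \<not> E1 u w"
    by (elim exE conjE)
  have S3: "\<not> E1 u w" if "u \<in> S" "w \<in> S" for u w
    using S1(3) that A.irrefl by (cases "u = w") auto
  note S = S1(1,2) S3
  have finS: "finite S" using S(1) V finite_subset by blast
  \<comment> \<open>Each vector gets the sign for which most of its inner products with \<open>S\<close> are positive.\<close>
  define \<sigma> :: "'a \<Rightarrow> real" where "\<sigma> v = (if 15 * k ^ 3 < card {s \<in> S. E1 v s} then - 1 else 1)" for v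
  define E where "E = switched_edge V d x \<sigma>"
  interpret B: gram_graph V E k d "\<lambda>v i. \<sigma> v * sqrt ((2 * real k - 1) / 2) * x v i"
    unfolding E_def by (rule switched_gram_graph[OF V k unit angle]) (auto simp: \<sigma>_def)
  have \<sigma>S: "\<sigma> s = 1" if "s \<in> S" for s
  proof -
    have "{t \<in> S. E1 s t} = {}" using S(3)[OF that] by blast
    then have "card {t \<in> S. E1 s t} = 0" by (simp only: card.empty)
    then show ?thesis unfolding \<sigma>_def by (simp only: not_less0 if_False)
  qed
  have indep: "\<not> E u w" if "u \<in> S" "w \<in> S" for u w
    using S(3)[OF that] \<sigma>S[OF that(1)] \<sigma>S[OF that(2)] by (simp add: E_def E1_def switched_edge_def)
  have half: "card {s \<in> S. E v s} \<le> 15 * k ^ 3" if v: "v \<in> V" for v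
  proof (cases "\<sigma> v = 1")
    case True
    then have "{s \<in> S. E v s} = {s \<in> S. E1 v s}"
      using \<sigma>S by (auto simp: E_def E1_def switched_edge_def)
    then show ?thesis using True by (simp add: \<sigma>_def split: if_splits)
  next
    case False
    then have flip: "\<sigma> v = - 1" "15 * k ^ 3 < card {s \<in> S. E1 v s}"
      by (auto simp: \<sigma>_def split: if_splits)
    have "{s \<in> S. E v s} \<subseteq> S - {s \<in> S. E1 v s}"
      using flip(1) \<sigma>S by (auto simp: E_def E1_def switched_edge_def)
    then have "card {s \<in> S. E v s} \<le> card (S - {s \<in> S. E1 v s})"
      using finS by (intro card_mono) auto
    also have "\<dots> = card S - card {s \<in> S. E1 v s}" using finS by (intro card_Diff_subset) auto
    finally show ?thesis using flip(2) S(2) by linarith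
  qed
  define D :: nat where "D = 2 ^ (2 * k + 1 + 3 * k\<^sup>2)"
  have deg: "card {w. E v w} \<le> D" if "v \<in> V" for v
    unfolding D_def by (rule B.degree_bound[OF S(1,2) indep half that])
  show ?thesis
  proof (cases "\<forall>z. B.ip (B.adj V z) z \<le> (real k - 1) * B.ip z z")
    case True
    then show ?thesis using B.card_bound_if_form_bounded d by blast
  next
    case False
    then obtain y where y: "(real k - 1) * B.ip y y < B.ip (B.adj V y) y" by (auto simp: not_le)
    define j where "j = 4 * k * k ^ (4 * k)"
    define W :: nat where "W = (D + 1) ^ (2 * (2 * k * j) + 1)"
    define N where "N = card V"
    have main: "real N - real N / real (2 * k + 1) - 2 - real W - real d
        \<le> real N * (1 - 1 / (real k - 1) ^ (2 * (2 * k))) ^ j"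
      using B.card_bound_if_form_exceeds[OF deg y, of "2 * k" j] by (simp only: W_def N_def of_nat_power)
    have "4 * k * (3 + W) \<le> N"
      using ball_threshold[OF k] large unfolding W_def D_def j_def N_def by (rule order_trans)
    then have "real (4 * k * (3 + W)) \<le> real N" by (rule of_nat_mono)
    then have W: "3 + real W \<le> real N / (4 * real k)" using k by (simp add: field_simps)
    have N: "0 < real N" using large V unfolding N_def
      by (metis less_le_trans of_nat_0_less_iff pos2 zero_less_power)
    show ?thesis
    proof (rule ccontr)
      assume "\<not> ?thesis"
      then have "k * (d - 1) < N * (k - 1)" by (simp add: N_def)
      then have "real (k * (d - 1)) < real (N * (k - 1))" by (rule of_nat_less_iff[THEN iffD2])
      then have "real k * (real d - 1) < real N * (real k - 1)" using k d by (simp add: of_nat_diff)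
      then have "real d < real N - real N / real k + 1" using k by (simp add: field_simps)
      moreover have "real N / real (2 * k + 1) \<le> real N / (2 * real k)"
        using N k by (intro divide_left_mono) auto
      moreover have "real N * (1 - 1 / (real k - 1) ^ (2 * (2 * k))) ^ j < real N / (4 * real k)"
        using mult_strict_left_mono[OF decay_estimate[OF k] N] by (simp add: j_def)
      moreover have "real N / real k = 4 * (real N / (4 * real k))" "real N / (2 * real k) = 2 * (real N / (4 * real k))"
        by simp_all
      ultimately show False using main W by linarith
    qed
  qed
qed

lemma equiangular_lines_bound:
  assumes L: "finite L" "L \<subseteq> lines_through_origin d" "equiangular (1 / (2 * real k - 1)) L"
    and k: "k \<ge> 2" and d: "k \<le> d" and large: "2 ^ (k ^ (4 * k + 12)) \<le> card L"
  shows "card L * (k - 1) \<le> k * (d - 1)"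
proof -
  have "\<exists>v. v \<in> unit_vectors_along l \<and> v \<in> carrier_vec d \<and> v \<bullet> v = 1" if l: "l \<in> L" for l
  proof -
    obtain u where u: "u \<in> carrier_vec d" "u \<noteq> 0\<^sub>v d" "l = range (\<lambda>c. c \<cdot>\<^sub>v u)"
      using L(2) l unfolding lines_through_origin_def by blast
    obtain i where i: "i < d" "u $ i \<noteq> 0" using u(1,2) by (metis carrier_vecD eq_vecI index_zero_vec)
    have "u \<bullet> u = (\<Sum>i<d. (u $ i)\<^sup>2)"
      using u(1) by (simp add: scalar_prod_def atLeast0LessThan power2_eq_square)
    also have "\<dots> > 0" using i by (intro sum_pos2[of _ i]) auto
    finally have pos: "u \<bullet> u > 0" .
    define v where "v = (1 / sqrt (u \<bullet> u)) \<cdot>\<^sub>v u"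
    have "v \<bullet> v = (1 / sqrt (u \<bullet> u)) * ((1 / sqrt (u \<bullet> u)) * (u \<bullet> u))"
      unfolding v_def using u(1) by simp
    also have "\<dots> = 1" using pos by simp
    finally have "v \<bullet> v = 1" .
    moreover have "v \<in> l" unfolding v_def u(3) by blast
    ultimately show ?thesis using u(1) by (auto simp: unit_vectors_along_def v_def)
  qed
  then obtain f :: "real vec set \<Rightarrow> real vec" where f: "\<And>l. l \<in> L \<Longrightarrow> f l \<in> unit_vectors_along l"
      "\<And>l. l \<in> L \<Longrightarrow> f l \<in> carrier_vec d" "\<And>l. l \<in> L \<Longrightarrow> f l \<bullet> f l = 1" by metis
  have prod: "(\<Sum>i<d. f l $ i * f m $ i) = f l \<bullet> f m" if "m \<in> L" for l m
    using f(2)[OF that] by (simp add: scalar_prod_def atLeast0LessThan)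
  show ?thesis
    by (rule equiangular_vectors_bound[where x = "\<lambda>l i. f l $ i", OF L(1) k d _ _ large])
       (use f L(3) in \<open>auto simp: prod equiangular_def\<close>)
qed

section \<open>Construction of many lines\<close>

text \<open>
  The vertices of a regular simplex with \<open>k\<close> vertices in \<open>\<real>\<^sup>k\<^sup>-\<^sup>1\<close>, centred at the origin: one vertex
  is the all-ones vector, and the others are multiples of the coordinate vectors, shifted by a
  common multiple of the all-ones vector.
\<close>

lemma simplex_inner_products:
  fixes k :: nat
  assumes k: "k \<ge> 2"
  defines "g \<equiv> (1 + 1 / sqrt k) / (real k - 1)"
  defines "\<tau> \<equiv> \<lambda>i t. if i < k - 1 then sqrt k * ((if i = t then 1 else 0) - g) else 1"
  assumes i: "i < k" and j: "j < k"
  shows "(\<Sum>t<k - 1. \<tau> i t * \<tau> j t) = (if i = j then real k - 1 else - 1)"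
proof -
  define s where "s = sqrt (real k)"
  have s: "s * s = real k" "s > 0" using k by (auto simp: s_def)
  define K where "K = real k - 1"
  have K: "K > 0" "real (k - 1) = K" using k by (auto simp: K_def of_nat_diff)
  have Kg: "K * g = 1 + 1 / s" using K by (simp add: g_def K_def s_def)
  have single: "(\<Sum>t<k - 1. \<tau> i t) = - 1" if "i < k - 1" for i
  proof -
    have "(\<Sum>t<k - 1. \<tau> i t) = s * (1 - K * g)"
      using that k by (simp add: \<tau>_def s_def K_def of_nat_diff sum_subtractf flip: sum_distrib_left)
    also have "\<dots> = - 1" using s(2) by (simp add: Kg)
    finally show ?thesis .
  qed
  consider "i < k - 1" "j < k - 1" | "i = k - 1" "j < k - 1" | "i < k - 1" "j = k - 1"
    | "i = k - 1" "j = k - 1" using i j by linarith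
  then show ?thesis
  proof cases
    case 1
    have "(\<Sum>t<k - 1. \<tau> i t * \<tau> j t)
        = (\<Sum>t<k - 1. (s * s) * ((if i = t then (if j = t then 1 else 0) else 0)
            - g * (if i = t then 1 else 0) - g * (if j = t then 1 else 0) + g * g))"
      using 1 by (intro sum.cong) (auto simp: \<tau>_def s_def algebra_simps)
    also have "\<dots> = (s * s) * ((if i = j then 1 else 0) - g - g + K * g * g)"
      using 1 k by (simp add: sum.distrib sum_subtractf K_def of_nat_diff flip: sum_distrib_left)
    also have "\<dots> = real k * (if i = j then 1 else 0) + real k * (g * (K * g - 2))"
      by (simp add: s algebra_simps)
    also have "real k * (g * (K * g - 2)) = - 1"
    proof -
      have "K * (real k * (g * (K * g - 2))) = (s * s) * ((K * g) * (K * g - 2))"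
        by (simp add: s)
      also have "\<dots> = (s * s) * ((1 + 1 / s) * (1 + 1 / s - 2))" by (simp only: Kg)
      also have "\<dots> = 1 - s * s" using s(2) by (simp add: field_simps)
      also have "\<dots> = K * (- 1)" by (simp add: s K_def)
      finally show ?thesis using K(1) by (metis mult_left_cancel order_less_irrefl)
    qed
    finally show ?thesis by simp
  next
    case 2
    then show ?thesis using single[of j] by (simp add: \<tau>_def)
  next
    case 3
    then show ?thesis using single[of i] by (simp add: \<tau>_def)
  next
    case 4
    then show ?thesis using K by (simp add: \<tau>_def K_def)
  qed
qed

lemma sum_over_block:
  fixes h :: "nat \<Rightarrow> real"
  assumes K: "K > 0" and L: "L = min K (m - b * K)"
  shows "(\<Sum>p<m. if p div K = b then h (p mod K) else 0) = (\<Sum>t<L. h t)"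
proof -
  have "(\<Sum>p<m. if p div K = b then h (p mod K) else 0) = (\<Sum>p\<in>{p. p < m \<and> p div K = b}. h (p mod K))"
    by (intro sum.mono_neutral_cong_right) auto
  also have "\<dots> = (\<Sum>t<L. h t)"
  proof (rule sum.reindex_bij_witness[of _ "\<lambda>t. b * K + t" "\<lambda>p. p mod K"])
    fix p assume p: "p \<in> {p. p < m \<and> p div K = b}"
    then have "p = b * K + p mod K" using div_mult_mod_eq[of p K] by simp
    then show "b * K + p mod K = p" by simp
    have "p < m" using p by simp
    then have "p mod K < m - b * K" using \<open>p = b * K + p mod K\<close> by linarith
    then show "p mod K \<in> {..<L}" using K unfolding L by simp
  next
    fix t assume t: "t \<in> {..<L}"
    then have "t < K" unfolding L by simp
    then show "(b * K + t) mod K = t" by simp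
    show "b * K + t \<in> {p. p < m \<and> p div K = b}" using t \<open>t < K\<close> unfolding L by auto
  qed auto
  finally show ?thesis .
qed

text \<open>
  Split \<open>m\<close> coordinates into blocks of length \<open>k - 1\<close> and place a simplex in each, which gives
  \<open>k\<close> vectors per block; an incomplete last block carries orthogonal vectors, one for each
  coordinate.  This corresponds to disjoint copies of the complete graph on \<open>k\<close> vertices, followed
  by isolated vertices.
\<close>

lemma block_simplices:
  fixes k m :: nat
  assumes k: "k \<ge> 2"
  shows "\<exists>z :: nat \<Rightarrow> nat \<Rightarrow> real. \<forall>n < k * m div (k - 1). \<forall>n' < k * m div (k - 1).
     (\<Sum>p<m. z n p * z n' p) = real k - 1 \<and> n = n' \<or>
     (\<Sum>p<m. z n p * z n' p) \<in> {-1, 0} \<and> n \<noteq> n'"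
proof -
  define K where "K = k - 1"
  have K: "K > 0" "k = K + 1" using k by (auto simp: K_def)
  define q where "q = m div K"
  define s where "s = m mod K"
  have m: "m = q * K + s" by (simp add: q_def s_def)
  have s: "s < K" using K by (simp add: s_def)
  have "k * m = m * K + m" using K by (simp add: algebra_simps)
  then have "k * m div K = m + q" using K by (simp add: q_def)
  then have "k * m div (k - 1) = m + q" by (simp add: K_def)
  moreover have "q * k + s = m + q" using m by (simp add: K(2))
  ultimately have M: "k * m div (k - 1) = q * k + s" by simp
  define g where "g = (1 + 1 / sqrt k) / (real k - 1)"
  define \<tau> where "\<tau> = (\<lambda>i t. if i < k - 1 then sqrt k * ((if i = t then 1 else 0) - g) else 1)"
  have \<tau>: "(\<Sum>t<K. \<tau> i t * \<tau> j t) = (if i = j then real k - 1 else - 1)" if "i < k" "j < k" for i j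
    unfolding \<tau>_def g_def K_def by (rule simplex_inner_products[OF k that])
  define \<zeta> where "\<zeta> b i t = (if b < q then \<tau> i t else if i = t then sqrt K else 0)" for b i t
  define z where "z n p = (if p div K = n div k then \<zeta> (n div k) (n mod k) (p mod K) else 0)" for n p
  have "(\<Sum>p<m. z n p * z n' p) = real k - 1 \<and> n = n' \<or> (\<Sum>p<m. z n p * z n' p) \<in> {-1, 0} \<and> n \<noteq> n'"
    if n: "n < q * k + s" "n' < q * k + s" for n n'
  proof (cases "n div k = n' div k")
    case False
    then have "(\<Sum>p<m. z n p * z n' p) = 0" by (intro sum.neutral) (auto simp: z_def)
    then show ?thesis using False by auto
  next
    case True
    define b where "b = n div k"
    define i where "i = n mod k"
    define j where "j = n' mod k"
    have nb: "n = b * k + i" "n' = b * k + j" "i < k" "j < k"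
      using True k div_mult_mod_eq[of n k] div_mult_mod_eq[of n' k] by (simp_all add: b_def i_def j_def)
    have eq: "n = n' \<longleftrightarrow> i = j" using nb by simp
    have "(\<Sum>p<m. z n p * z n' p) = (\<Sum>p<m. if p div K = b then \<zeta> b i (p mod K) * \<zeta> b j (p mod K) else 0)"
      using True by (intro sum.cong) (auto simp: z_def b_def i_def j_def)
    also have "\<dots> = (\<Sum>t<min K (m - b * K). \<zeta> b i t * \<zeta> b j t)"
      by (rule sum_over_block[OF K(1) refl])
    finally have sum: "(\<Sum>p<m. z n p * z n' p) = (\<Sum>t<min K (m - b * K). \<zeta> b i t * \<zeta> b j t)" .
    show ?thesis
    proof (cases "b < q")
      case bq: True
      then have "(b + 1) * K \<le> q * K" by (intro mult_le_mono1) simp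
      then have "min K (m - b * K) = K" using m by simp
      then have "(\<Sum>p<m. z n p * z n' p) = (if i = j then real k - 1 else - 1)"
        using sum bq \<tau>[OF nb(3,4)] by (simp add: \<zeta>_def)
      then show ?thesis using eq by auto
    next
      case False
      have "b * k < (q + 1) * k" using n(1) nb(1) s K by simp
      then have "b < q + 1" by (rule mult_less_cancel2[THEN iffD1, THEN conjunct2])
      then have bq: "b = q" using False by simp
      then have ij: "i < s" "j < s" using n nb by auto
      have "min K (m - b * K) = s" using m s bq by simp
      then have "(\<Sum>p<m. z n p * z n' p) = (\<Sum>t<s. if i = t then (if j = t then sqrt K * sqrt K else 0) else 0)"
        unfolding sum using bq by (intro sum.cong) (auto simp: \<zeta>_def)
      also have "\<dots> = (if i = j then real K else 0)" using ij by simp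
      finally show ?thesis using eq K by auto
    qed
  qed
  then show ?thesis unfolding M by blast
qed

lemma equiangular_lines_from_vectors:
  fixes x :: "nat \<Rightarrow> nat \<Rightarrow> real"
  assumes a: "0 \<le> a" "a < 1"
    and unit: "\<And>n. n < M \<Longrightarrow> (\<Sum>i<d. (x n i)\<^sup>2) = 1"
    and angle: "\<And>n m. n < M \<Longrightarrow> m < M \<Longrightarrow> n \<noteq> m \<Longrightarrow> \<bar>\<Sum>i<d. x n i * x m i\<bar> = a"
  shows "\<exists>L. finite L \<and> L \<subseteq> lines_through_origin d \<and> equiangular a L \<and> card L = M"
proof -
  define u where "u n = vec d (x n)" for n
  define l where "l n = range (\<lambda>c. c \<cdot>\<^sub>v u n)" for n
  have u: "u n \<in> carrier_vec d" for n by (simp add: u_def)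
  have prod: "u n \<bullet> u m = (\<Sum>i<d. x n i * x m i)" for n m
    by (simp add: scalar_prod_def u_def atLeast0LessThan)
  have unit': "u n \<bullet> u n = 1" if "n < M" for n
    using unit[OF that] by (simp add: prod power2_eq_square)
  have scaled: "(c \<cdot>\<^sub>v u n) \<bullet> (c' \<cdot>\<^sub>v u m) = c * c' * (u n \<bullet> u m)" for c c' n m
    using smult_scalar_prod_distrib[OF u, of "c' \<cdot>\<^sub>v u m" c n]
      scalar_prod_smult_distrib[OF u u, of n c' m] u by simp
  have along: "\<exists>c. \<bar>c\<bar> = 1 \<and> v = c \<cdot>\<^sub>v u n" if "v \<in> unit_vectors_along (l n)" "n < M" for v n
  proof -
    from that obtain c where c: "v = c \<cdot>\<^sub>v u n" "sqrt (v \<bullet> v) = 1"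
      by (auto simp: unit_vectors_along_def l_def)
    then have "\<bar>c\<bar> = 1" using unit'[OF that(2)] scaled[of c n c n] by simp
    then show ?thesis using c by blast
  qed
  have inj: "inj_on l {..<M}"
  proof (rule inj_onI, rule ccontr)
    fix n m assume nm: "n \<in> {..<M}" "m \<in> {..<M}" "l n = l m" "n \<noteq> m"
    have "u m = 1 \<cdot>\<^sub>v u m" by simp
    then have "u m \<in> l m" unfolding l_def by blast
    then have "u m \<in> unit_vectors_along (l n)" using nm unit' by (simp add: unit_vectors_along_def)
    then obtain c where c: "\<bar>c\<bar> = 1" "u m = c \<cdot>\<^sub>v u n" using along nm(1) by blast
    have "u n \<bullet> u m = c * (u n \<bullet> u n)" unfolding c(2) using u by simp
    then have "\<bar>u n \<bullet> u m\<bar> = 1" using c(1) unit' nm(1) by simp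
    then show False using angle[of n m] nm a by (simp add: prod)
  qed
  have "l n \<in> lines_through_origin d" if "n < M" for n
  proof -
    have "u n \<noteq> 0\<^sub>v d" using unit'[OF that] by auto
    then show ?thesis using u unfolding lines_through_origin_def l_def by blast
  qed
  moreover have "equiangular a (l ` {..<M})"
    unfolding equiangular_def
  proof (intro ballI impI)
    fix p q v w
    assume p: "p \<in> l ` {..<M}" and q: "q \<in> l ` {..<M}" and pq: "p \<noteq> q"
      and v: "v \<in> unit_vectors_along p" and w: "w \<in> unit_vectors_along q"
    from p q obtain n m where nm: "p = l n" "n < M" "q = l m" "m < M" by auto
    obtain c where c: "\<bar>c\<bar> = 1" "v = c \<cdot>\<^sub>v u n" using along v nm by blast
    obtain c' where c': "\<bar>c'\<bar> = 1" "w = c' \<cdot>\<^sub>v u m" using along w nm by blast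
    have "\<bar>v \<bullet> w\<bar> = \<bar>u n \<bullet> u m\<bar>" using c c' by (simp only: scaled abs_mult)
    then show "\<bar>v \<bullet> w\<bar> = a" using angle[of n m] nm pq by (auto simp: prod)
  qed
  ultimately show ?thesis using inj
    by (intro exI[of _ "l ` {..<M}"]) (auto simp: card_image)
qed

text \<open>
  An additional common coordinate raises every inner product of the block simplices by \<open>1/2\<close>.
  It turns their values \<open>k - 1\<close>, \<open>-1\<close> and \<open>0\<close> into \<open>(2k-1)/2\<close>, \<open>-1/2\<close> and
  \<open>1/2\<close>.
\<close>

lemma many_equiangular_lines:
  fixes k d :: nat
  assumes k: "k \<ge> 2" and d: "d \<ge> 1"
  shows "\<exists>L. finite L \<and> L \<subseteq> lines_through_origin d \<and> equiangular (1 / (2 * real k - 1)) L \<and>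
           card L = k * (d - 1) div (k - 1)"
proof -
  define M where "M = k * (d - 1) div (k - 1)"
  obtain z :: "nat \<Rightarrow> nat \<Rightarrow> real" where z: "\<And>n n'. n < M \<Longrightarrow> n' < M \<Longrightarrow>
     (\<Sum>p<d - 1. z n p * z n' p) = real k - 1 \<and> n = n' \<or>
     (\<Sum>p<d - 1. z n p * z n' p) \<in> {-1, 0} \<and> n \<noteq> n'"
    using block_simplices[OF k, of "d - 1"] unfolding M_def by blast
  define b where "b = 2 * real k - 1"
  have b: "b > 1" using k by (simp add: b_def)
  define x where "x n i = sqrt (2 / b) * (case i of 0 \<Rightarrow> sqrt (1 / 2) | Suc p \<Rightarrow> z n p)" for n i
  have prod: "(\<Sum>i<d. x n i * x m i) = 2 / b * (1 / 2 + (\<Sum>p<d - 1. z n p * z m p))" for n m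
  proof -
    obtain d' where d': "d = Suc d'" using d by (cases d) auto
    have "x n 0 * x m 0 = 2 / b * (1 / 2)"
      using b by (simp add: x_def mult.assoc mult.left_commute real_sqrt_mult_self flip: real_sqrt_mult)
    moreover have "x n (Suc p) * x m (Suc p) = 2 / b * (z n p * z m p)" for p
    proof -
      have "x n (Suc p) * x m (Suc p) = (sqrt (2 / b) * sqrt (2 / b)) * (z n p * z m p)"
        by (simp only: x_def nat.case mult_ac)
      then show ?thesis using b by simp
    qed
    ultimately show ?thesis
      unfolding d' sum.lessThan_Suc_shift by (simp add: distrib_left sum_distrib_left)
  qed
  have "\<exists>L. finite L \<and> L \<subseteq> lines_through_origin d \<and> equiangular (1 / b) L \<and> card L = M"
  proof (rule equiangular_lines_from_vectors[where x = x])
    show "0 \<le> 1 / b" "1 / b < 1" using b by auto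
    fix n assume n: "n < M"
    show "(\<Sum>i<d. (x n i)\<^sup>2) = 1"
      using z[OF n n] b by (simp add: power2_eq_square prod) (simp add: b_def field_simps)
    fix m assume m: "m < M" "n \<noteq> m"
    then show "\<bar>\<Sum>i<d. x n i * x m i\<bar> = 1 / b"
      using z[OF n m(1)] b by (auto simp: prod)
  qed
  then show ?thesis by (simp add: b_def M_def)
qed

section \<open>The maximum number of lines\<close>

theorem corollary1p6:
  shows "\<exists>C::real. C > 0 \<and>
    (\<forall>(r::nat) (k::nat). r \<ge> 1 \<longrightarrow> k \<ge> 2 \<longrightarrow>
       real r \<ge> 2 powr (real k powr (C * real k)) \<longrightarrow>
       int (max_equiangular (1 / (2 * real k - 1)) r) =
         \<lfloor>real k / (real k - 1) * (real r - 1)\<rfloor>)"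
proof (intro exI[of _ "10::real"] conjI allI impI)
  \<comment> \<open>The constant is \<open>10\<close> because \<open>4 k + 12 \<le> 10 k\<close> for \<open>k \<ge> 2\<close>.\<close>
  fix r k :: nat
  assume r: "r \<ge> 1" and k: "k \<ge> 2" and large: "real r \<ge> 2 powr (real k powr (10 * real k))"
  define M where "M = k * (r - 1) div (k - 1)"
  have "real k powr (10 * real k) = real (k ^ (10 * k))"
    using k powr_realpow[of "real k" "10 * k"] by simp
  then have "2 powr (real k powr (10 * real k)) = real (2 ^ (k ^ (10 * k)))"
    using powr_realpow[of 2 "k ^ (10 * k)"] by simp
  then have r_large: "2 ^ (k ^ (10 * k)) \<le> r" using large by (simp only: of_nat_le_iff)
  have "k ^ (4 * k + 12) \<le> k ^ (10 * k)" using k by (intro power_increasing) auto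
  then have "(2::nat) ^ (k ^ (4 * k + 12)) \<le> 2 ^ (k ^ (10 * k))" by (rule power_increasing) simp
  then have threshold: "2 ^ (k ^ (4 * k + 12)) \<le> r" using r_large by (rule order_trans)
  have "k \<le> k ^ (10 * k)" using k by (intro self_le_power) auto
  also have "\<dots> < 2 ^ (k ^ (10 * k))" by (rule less_exp)
  also note r_large
  finally have kr: "k \<le> r" by simp
  have upper: "card L \<le> M"
    if L: "finite L" "L \<subseteq> lines_through_origin r" "equiangular (1 / (2 * real k - 1)) L" for L
  proof -
    have "card L * (k - 1) \<le> k * (r - 1)"
    proof (cases "2 ^ (k ^ (4 * k + 12)) \<le> card L")
      case True
      then show ?thesis by (rule equiangular_lines_bound[OF L k kr])
    next
      \<comment> \<open>A family below the threshold has fewer than \<open>r\<close> lines and satisfies the bound trivially.\<close>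
      case False
      then have "card L < r" using threshold by (simp only: not_le less_le_trans)
      then have "card L \<le> r - 1" by simp
      then have "card L * (k - 1) \<le> (r - 1) * k" by (rule mult_le_mono) simp
      then show ?thesis by (simp add: mult.commute)
    qed
    then show ?thesis using k by (simp add: M_def less_eq_div_iff_mult_less_eq)
  qed
  obtain L where "finite L \<and> L \<subseteq> lines_through_origin r \<and>
      equiangular (1 / (2 * real k - 1)) L \<and> card L = M"
    using many_equiangular_lines[OF k r] unfolding M_def by blast
  then have "max_equiangular (1 / (2 * real k - 1)) r = M"
    unfolding max_equiangular_def
    by (intro Max_eqI) (use upper in \<open>auto intro: finite_subset[of _ "{..M}"]\<close>)
  moreover have "\<lfloor>real k / (real k - 1) * (real r - 1)\<rfloor> = int M"
  proof -
    have "real k / (real k - 1) * (real r - 1) = real (k * (r - 1)) / real (k - 1)"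
      using k r by (simp add: of_nat_diff)
    then show ?thesis by (simp only: M_def floor_divide_of_nat_eq)
  qed
  ultimately show "int (max_equiangular (1 / (2 * real k - 1)) r)
      = \<lfloor>real k / (real k - 1) * (real r - 1)\<rfloor>" by simp
qed simp

end
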